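(* Let $L$ be a ladder with upper outside corners $(b_1,a_1),\dots,(b_h,a_h)$ and lower outside corners $(d_1,c_1),\dots,(d_k,c_k)$, and let $t=(t_1,\dots,t_k)$ be a vector of positive integers. Let $L'$ be the subladder of $L$ with the same upper outside corners as $L$ and with lower outside corners $\{(d_j-t_j+1,\ c_j+t_j-1) : 1\le j\le k\}$, i.e. $L'$ is the set of $x_{b,a}\in X$ for which there exist $i\in\{1,\dots,h\}$ and $j\in\{1,\dots,k\}$ with $b_i\le b\le d_j-t_j+1$ and $c_j+t_j-1\le a\le a_i$. Then $$\mathrm{ht}\, I_t(L)=|L'| ,$$ where $I_t(L)\subset K[L]$ is the mixed ladder determinantal ideal.
   Context: $K$ is an algebraically closed field. $X=(x_{b,a})$ is an $m\times n$ matrix of distinct indeterminates over $K$ ($x_{b,a}$ lies in row $b$ and column $a$), with $m\le n$. Ladder: given integers $1=b_1<\cdots<b_h\le m$, $1\le a_1<\cdots<a_h=n$ (the upper outside corners are $(b_i,a_i)$) and $1\le d_1\le\cdots\le d_k=m$, $1=c_1\le\cdots\le c_k\le n$ with the pairs $(d_j,c_j)$ distinct (the lower outside corners), the associated ladder is the set $L$ of all $x_{b,a}$ for which there are $i,j$ with $b_i\le b\le d_j$ and $c_j\le a\le a_i$. Put $L_j=\{x_{b,a}\in L: b\le d_j,\ a\ge c_j\}$, so $L=\bigcup_j L_j$. $K[L]$ is the polynomial ring in the entries of $L$. For $s\ge1$, $I_s(L_j)\subset K[L]$ is the ideal generated by all $s\times s$ minors of $X$ all of whose entries lie in $L_j$.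 The mixed ladder determinantal ideal is $I_t(L)=I_{t_1}(L_1)+\cdots+I_{t_k}(L_k)$. Standing assumptions: every entry of $L$ is an entry of some $t_j\times t_j$ submatrix contained in $L_j$ for some $j$; and $I_{t_i}(L_i)\not\subseteq I_{t_j}(L_j)$ for $i\ne j$, so that $d_{j+1}-d_j>t_{j+1}-t_j$ and $c_{j+1}-c_j>t_j-t_{j+1}$ for $1\le j<k$. *)

theory Defs
  imports
    "HOL-Algebra.Ideal"
    "HOL-Library.Extended_Nat"
    "HOL-Library.Poly_Mapping"
    "HOL-Computational_Algebra.Polynomial"
    "Jordan_Normal_Form.Determinant"
    "Jordan_Normal_Form.DL_Submatrix"
begin

section \<open>Height of an ideal\<close>

definition prime_height :: "('r, 'q) ring_scheme \<Rightarrow> 'r set \<Rightarrow> enat" where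
  "prime_height R P = Sup {enat l | l. \<exists>Q :: nat \<Rightarrow> 'r set.
     (\<forall>i\<le>l. primeideal (Q i) R) \<and> (\<forall>i<l. Q i \<subset> Q (Suc i)) \<and> Q l = P}"

definition ideal_height :: "('r, 'q) ring_scheme \<Rightarrow> 'r set \<Rightarrow> enat" where
  "ideal_height R I = Inf {prime_height R P | P. primeideal P R \<and> I \<subseteq> P}"

section \<open>Polynomials in the entries of a set of matrix positions\<close>

text \<open>The pair \<open>(r, s)\<close> stands for the indeterminate in row \<open>r\<close> and column \<open>s\<close>, both
  counted from 1. The polynomials in all these indeterminates form one type, and \<open>poly_ring V\<close> is
  the subring of those polynomials that involve only the indeterminates in \<open>V\<close>.\<close>

type_synonym 'k mpoly = "(nat \<times> nat \<Rightarrow>\<^sub>0 nat) \<Rightarrow>\<^sub>0 'k"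

definition indet :: "nat \<times> nat \<Rightarrow> 'k::comm_ring_1 mpoly" where
  "indet v = Poly_Mapping.single (Poly_Mapping.single v 1) 1"

definition poly_ring :: "(nat \<times> nat) set \<Rightarrow> 'k::comm_ring_1 mpoly ring" where
  "poly_ring V = \<lparr>carrier = {p. \<forall>u \<in> Poly_Mapping.keys p. Poly_Mapping.keys u \<subseteq> V},
     monoid.mult = (*), one = 1, zero = 0, add = (+)\<rparr>"

lemma cring_poly_ring: "cring (poly_ring V :: 'k::comm_ring_1 mpoly ring)"
proof -
  let ?R = "poly_ring V :: 'k mpoly ring"
  have zero: "\<zero>\<^bsub>?R\<^esub> \<in> carrier ?R" and one: "\<one>\<^bsub>?R\<^esub> \<in> carrier ?R"
    by (simp_all add: poly_ring_def)
  have uminus: "- p \<in> carrier ?R" if "p \<in> carrier ?R" for p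
    using that by (simp add: poly_ring_def)
  have add: "p + q \<in> carrier ?R" if "p \<in> carrier ?R" "q \<in> carrier ?R" for p q
  proof -
    have "Poly_Mapping.keys (p + q) \<subseteq> Poly_Mapping.keys p \<union> Poly_Mapping.keys q"
      by (rule Poly_Mapping.keys_add)
    then show ?thesis using that unfolding poly_ring_def by auto
  qed
  have mult: "p * q \<in> carrier ?R" if p: "p \<in> carrier ?R" and q: "q \<in> carrier ?R" for p q
  proof -
    have "Poly_Mapping.keys u \<subseteq> V" if pq: "u \<in> Poly_Mapping.keys (p * q)" for u
    proof -
      obtain v w where u: "u = v + w"
        and v: "v \<in> Poly_Mapping.keys p" and w: "w \<in> Poly_Mapping.keys q"
        using subsetD[OF Poly_Mapping.keys_mult pq] by blast
      have "Poly_Mapping.keys u \<subseteq> Poly_Mapping.keys v \<union> Poly_Mapping.keys w"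
        unfolding u by (rule Poly_Mapping.keys_add)
      moreover have "Poly_Mapping.keys v \<subseteq> V" "Poly_Mapping.keys w \<subseteq> V"
        using p q v w by (simp_all add: poly_ring_def)
      ultimately show ?thesis by blast
    qed
    then show ?thesis by (simp add: poly_ring_def)
  qed
  have ops: "x \<otimes>\<^bsub>?R\<^esub> y = x * y" "x \<oplus>\<^bsub>?R\<^esub> y = x + y" "\<one>\<^bsub>?R\<^esub> = 1" "\<zero>\<^bsub>?R\<^esub> = 0" for x y
    by (simp_all add: poly_ring_def)
  show ?thesis
  proof (rule cringI)
    show "abelian_group ?R"
    proof (rule abelian_groupI, unfold ops)
      show "\<exists>q\<in>carrier ?R. q + p = 0" if "p \<in> carrier ?R" for p
        using uminus[OF that] by (intro bexI[of _ "- p"]) simp_all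
    qed (use zero add in \<open>simp_all only: ops add_0 add_0_right add_ac\<close>)
    show "Group.comm_monoid ?R"
      by (rule comm_monoidI, unfold ops)
        (use one mult in \<open>simp_all only: ops mult_1 mult_1_right mult_ac\<close>)
  qed (simp add: ops distrib_right)
qed

section \<open>Ladders\<close>

text \<open>Upper outside corners \<open>(b i, a i)\<close> for \<open>1 \<le> i \<le> h\<close> and lower outside corners
  \<open>(d j, c j)\<close> for \<open>1 \<le> j \<le> k\<close>.\<close>

definition ladder ::
  "nat \<Rightarrow> (nat \<Rightarrow> nat) \<Rightarrow> (nat \<Rightarrow> nat) \<Rightarrow> nat \<Rightarrow> (nat \<Rightarrow> nat) \<Rightarrow> (nat \<Rightarrow> nat) \<Rightarrow> (nat \<times> nat) set" where
  "ladder h b a k d c =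
     {(r, s). \<exists>i\<in>{1..h}. \<exists>j\<in>{1..k}. b i \<le> r \<and> r \<le> d j \<and> c j \<le> s \<and> s \<le> a i}"

text \<open>\<open>ladder_part L d c j\<close> is the part \<open>L\<^sub>j\<close> of \<open>L\<close>.\<close>

definition ladder_part ::
  "(nat \<times> nat) set \<Rightarrow> (nat \<Rightarrow> nat) \<Rightarrow> (nat \<Rightarrow> nat) \<Rightarrow> nat \<Rightarrow> (nat \<times> nat) set" where
  "ladder_part L d c j = {(r, s) \<in> L. r \<le> d j \<and> c j \<le> s}"

text \<open>The row bound is written \<open>d j + 1 - t j\<close> because subtraction truncates at 0: if
  \<open>d j + 1 \<le> t j\<close>, it becomes 0 and, as \<open>b i \<ge> 1\<close>, the corner contributes nothing.\<close>

definition subladder ::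
  "nat \<Rightarrow> (nat \<Rightarrow> nat) \<Rightarrow> (nat \<Rightarrow> nat) \<Rightarrow> nat \<Rightarrow> (nat \<Rightarrow> nat) \<Rightarrow> (nat \<Rightarrow> nat) \<Rightarrow> (nat \<Rightarrow> nat) \<Rightarrow>
     (nat \<times> nat) set" where
  "subladder h b a k d c t = ladder h b a k (\<lambda>j. d j + 1 - t j) (\<lambda>j. c j + t j - 1)"

section \<open>Mixed ladder determinantal ideals\<close>

text \<open>Matrices are indexed from 0, the indeterminates from 1.\<close>

definition generic_matrix :: "nat \<Rightarrow> nat \<Rightarrow> 'k::comm_ring_1 mpoly mat" where
  "generic_matrix m n = mat m n (\<lambda>(p, q). indet (Suc p, Suc q))"

definition minors_in :: "nat \<Rightarrow> nat \<Rightarrow> nat \<Rightarrow> (nat \<times> nat) set \<Rightarrow> 'k::comm_ring_1 mpoly set" where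
  "minors_in m n s M =
     {det (submatrix (generic_matrix m n) A B) | A B.
        A \<subseteq> {..<m} \<and> B \<subseteq> {..<n} \<and> card A = s \<and> card B = s \<and> Suc ` A \<times> Suc ` B \<subseteq> M}"

text \<open>The ideal of \<open>K[L]\<close> generated by the \<open>s \<times> s\<close> minors with all entries in \<open>M\<close>.\<close>

definition minor_ideal ::
  "nat \<Rightarrow> nat \<Rightarrow> (nat \<times> nat) set \<Rightarrow> nat \<Rightarrow> (nat \<times> nat) set \<Rightarrow> 'k::comm_ring_1 mpoly set" where
  "minor_ideal m n L s M = Idl\<^bsub>poly_ring L\<^esub> (minors_in m n s M)"

definition mixed_ladder_ideal ::
  "nat \<Rightarrow> nat \<Rightarrow> (nat \<times> nat) set \<Rightarrow> nat \<Rightarrow> (nat \<Rightarrow> nat) \<Rightarrow> (nat \<Rightarrow> nat) \<Rightarrow> (nat \<Rightarrow> nat) \<Rightarrow>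
     'k::comm_ring_1 mpoly set" where
  "mixed_ladder_ideal m n L k d c t =
     {\<Sum>j = 1..k. f j | f. \<forall>j\<in>{1..k}. f j \<in> minor_ideal m n L (t j) (ladder_part L d c j)}"

end

theory Submission
  imports Defs "HOL-Library.Product_Lexorder"
begin

text \<open>Two elementary facts replace dimension theory. A prime \<open>P\<close> of \<open>K[L]\<close> is the end of a chain of
  \<open>|L| - |B|\<close> strict inclusions of primes, where \<open>B\<close> is a maximal set of indeterminates that are
  algebraically independent modulo \<open>P\<close> (adjoin the indeterminates one by one). Conversely, along a
  chain that ends in \<open>P\<close>, each strict inclusion gives one more algebraically independent element, so
  if the indeterminates in \<open>B\<close> are independent modulo \<open>P\<close>, then the chain has length at most
  \<open>|L| - |B|\<close>.

  Lower bound: a minor whose antidiagonal lies on a line \<open>r + s = e\<close> permits replacing the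
  antidiagonal term by terms of larger weight \<open>\<Sum> (r + s)\<^sup>2\<close>. Modulo \<open>P\<close> all polynomials are therefore
  combinations of monomials whose support contains no such antidiagonal. Such a support has at most
  \<open>|L - L'|\<close> elements on comparing it with \<open>L - L'\<close> on each line, and counting monomials of bounded
  degree gives \<open>|B| \<le> |L - L'|\<close>.

  Upper bound: generic values at the positions outside \<open>L'\<close> extend to a matrix that satisfies all
  rank conditions. So no nonzero polynomial in the entries of \<open>L - L'\<close> vanishes on the zero set of
  the ideal, and some prime over the ideal meets \<open>K[L - L']\<close> only in 0.\<close>

text \<open>The upper bound needs a single prime over the ideal, but the lower bound must hold for
  every such prime, of which nothing is known except that it contains the minors. Both are therefore
  phrased through sets of indeterminates that are independent modulo a prime:
  \<open>|L - L'|\<close> bounds their size for all these primes and is attained for one of them.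

  The standard monomials are only asked to span the residue ring. On a line \<open>r + s = e\<close>
  the antidiagonal term is singled out by strict convexity of the square, and restricting to such
  antidiagonals splits the count into separate counts on the lines. Rewriting preserves the degree
  and \<open>L\<close> is finite, so the weight cannot grow forever.

  The obstacle in the upper bound is the overlap of the blocks: several rank conditions may
  prescribe the same entry. The non-containment assumption turns into inequalities between the
  corners, which keep the invertible square of each block clear of all entries that have to be
  filled in. Algebraic closedness enters as infinitude of the field, which supplies the generic
  values.\<close>

abbreviation lookup where "lookup \<equiv> Poly_Mapping.lookup"
abbreviation keys where "keys \<equiv> Poly_Mapping.keys"
abbreviation single where "single \<equiv> Poly_Mapping.single"

subsection \<open>Evaluation of polynomials\<close>

definition polys :: "(nat \<times> nat) set \<Rightarrow> 'k::comm_ring_1 mpoly set" where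
  "polys V = {p. \<forall>u \<in> keys p. keys u \<subseteq> V}"

lemma poly_ring_simps [simp]:
  "carrier (poly_ring V) = polys V" "p \<otimes>\<^bsub>poly_ring V\<^esub> q = p * q" "p \<oplus>\<^bsub>poly_ring V\<^esub> q = p + q"
  "\<one>\<^bsub>poly_ring V\<^esub> = 1" "\<zero>\<^bsub>poly_ring V\<^esub> = 0"
  by (simp_all add: poly_ring_def polys_def)

lemma polys_zero [simp, intro]: "0 \<in> polys V" and polys_one [simp, intro]: "1 \<in> polys V"
  by (simp_all add: polys_def)

lemma polys_add [intro]: "p \<in> polys V \<Longrightarrow> q \<in> polys V \<Longrightarrow> p + q \<in> polys V"
  using cring.cring_simprules(1)[OF cring_poly_ring[of V]] by simp

lemma polys_mult [intro]: "p \<in> polys V \<Longrightarrow> q \<in> polys V \<Longrightarrow> p * q \<in> polys V"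
  using cring.cring_simprules(5)[OF cring_poly_ring[of V]] by simp

lemma polys_uminus [intro]: "p \<in> polys V \<Longrightarrow> - p \<in> polys V"
  by (simp add: polys_def)

lemma polys_sum [intro]: "(\<And>i. i \<in> I \<Longrightarrow> f i \<in> polys V) \<Longrightarrow> sum f I \<in> polys V"
  by (induction I rule: infinite_finite_induct) auto

lemma polys_prod [intro]: "(\<And>i. i \<in> I \<Longrightarrow> f i \<in> polys V) \<Longrightarrow> prod f I \<in> polys V"
  by (induction I rule: infinite_finite_induct) auto

lemma polys_power [intro]: "p \<in> polys V \<Longrightarrow> p ^ e \<in> polys V"
  by (induction e) auto

lemma polys_single: "keys u \<subseteq> V \<Longrightarrow> single u c \<in> polys V"
  by (auto simp: polys_def)

lemma polys_const [simp, intro]: "single 0 c \<in> polys V"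
  by (simp add: polys_single)

lemma polys_indet [intro]: "v \<in> V \<Longrightarrow> indet v \<in> polys V"
  unfolding indet_def by (rule polys_single) simp

lemma polys_mono: "V \<subseteq> W \<Longrightarrow> polys V \<subseteq> polys W"
  by (auto simp: polys_def)

lemma poly_mapping_sum_single: "p = (\<Sum>u\<in>keys p. single u (lookup p u))"
proof (rule poly_mapping_eqI)
  fix w
  have "lookup (\<Sum>u\<in>keys p. single u (lookup p u)) w = (\<Sum>u\<in>keys p. if u = w then lookup p u else 0)"
    by (simp add: lookup_sum lookup_single when_def)
  then show "lookup p w = lookup (\<Sum>u\<in>keys p. single u (lookup p u)) w"
    by (simp add: in_keys_iff)
qed

lemma polys_induct [consumes 1, case_names single add]:
  assumes p: "p \<in> polys V"
    and single: "\<And>u c. keys u \<subseteq> V \<Longrightarrow> P (single u c)"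
    and add: "\<And>p q. p \<in> polys V \<Longrightarrow> q \<in> polys V \<Longrightarrow> P p \<Longrightarrow> P q \<Longrightarrow> P (p + q)"
  shows "P p"
proof -
  have "P (\<Sum>u\<in>S. single u (lookup p u))" if "finite S" "S \<subseteq> keys p" for S
    using that
  proof (induction S rule: finite_induct)
    case empty
    show ?case using single[of 0 0] by simp
  next
    case (insert u S)
    have "keys w \<subseteq> V" if "w \<in> insert u S" for w
      using p insert.prems that by (auto simp: polys_def)
    then have "P (single u (lookup p u) + (\<Sum>u\<in>S. single u (lookup p u)))"
      using insert by (intro add polys_sum polys_single single) auto
    then show ?case using insert by simp
  qed
  from this[of "keys p"] show ?thesis using poly_mapping_sum_single[of p] by simp
qed

lemma polys_empty: "p \<in> polys {} \<Longrightarrow> p = single 0 (lookup p 0)"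
  by (induction p rule: polys_induct) (auto simp: lookup_add single_add)

lemma mpoly_in_polys: "p \<in> polys UNIV"
  by (simp add: polys_def)

section \<open>Substitution into monomials and polynomials\<close>

definition monom_val :: "(nat \<times> nat \<Rightarrow> 'r::comm_ring_1) \<Rightarrow> (nat \<times> nat \<Rightarrow>\<^sub>0 nat) \<Rightarrow> 'r" where
  "monom_val \<sigma> u = (\<Prod>v\<in>keys u. \<sigma> v ^ lookup u v)"

text \<open>The coefficient map \<open>h\<close> is a parameter because three targets occur: the
  field itself (\<open>h\<close> the identity), polynomials (\<open>h = single 0\<close>), and
  univariate polynomials over polynomials in \<open>to_univ\<close>.\<close>

definition poly_val :: "('k::comm_ring_1 \<Rightarrow> 'r::comm_ring_1) \<Rightarrow> (nat \<times> nat \<Rightarrow> 'r) \<Rightarrow> 'k mpoly \<Rightarrow> 'r" where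
  "poly_val h \<sigma> p = (\<Sum>u\<in>keys p. h (lookup p u) * monom_val \<sigma> u)"

lemma monom_val_superset:
  assumes "finite S" "keys u \<subseteq> S"
  shows "monom_val \<sigma> u = (\<Prod>v\<in>S. \<sigma> v ^ lookup u v)"
  unfolding monom_val_def by (rule prod.mono_neutral_left) (use assms in \<open>auto simp: in_keys_iff\<close>)

lemma monom_val_zero [simp]: "monom_val \<sigma> 0 = 1"
  by (simp add: monom_val_def)

lemma monom_val_add: "monom_val \<sigma> (u + w) = monom_val \<sigma> u * monom_val \<sigma> w"
proof -
  let ?S = "keys u \<union> keys w"
  have "monom_val \<sigma> x = (\<Prod>v\<in>?S. \<sigma> v ^ lookup x v)" if "x \<in> {u, w, u + w}" for x
    by (rule monom_val_superset) (use that Poly_Mapping.keys_add[of u w] in auto)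
  then show ?thesis by (simp add: lookup_add power_add prod.distrib)
qed

lemma monom_val_single [simp]: "monom_val \<sigma> (single v e) = \<sigma> v ^ e"
  by (cases "e = 0") (simp_all add: monom_val_def)

lemma monom_val_cong: "(\<And>v. v \<in> keys u \<Longrightarrow> \<sigma> v = \<tau> v) \<Longrightarrow> monom_val \<sigma> u = monom_val \<tau> u"
  by (simp add: monom_val_def)

lemma poly_val_cong:
  "p \<in> polys V \<Longrightarrow> (\<And>v. v \<in> V \<Longrightarrow> \<sigma> v = \<tau> v) \<Longrightarrow> poly_val h \<sigma> p = poly_val h \<tau> p"
  unfolding poly_val_def polys_def by (intro sum.cong refl arg_cong2[of _ _ _ _ "(*)"] monom_val_cong) auto

lemma monom_val_indet: "monom_val indet u = (single u 1 :: 'k::comm_ring_1 mpoly)"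
proof -
  have pow: "(indet v ^ e :: 'k mpoly) = single (single v e) 1" for v e
    by (induction e) (simp_all add: indet_def mult_single flip: single_add)
  have "(\<Prod>v\<in>S. single (single v (lookup u v)) (1::'k)) = single (\<Sum>v\<in>S. single v (lookup u v)) 1"
    if "finite S" for S
    using that by (induction S rule: finite_induct) (simp_all add: mult_single)
  then show ?thesis
    by (simp add: monom_val_def pow flip: poly_mapping_sum_single)
qed

context
  fixes h :: "'k::comm_ring_1 \<Rightarrow> 'r::comm_ring_1"
  assumes h: "comm_ring_hom h"
begin

interpretation h: comm_ring_hom h by (rule h)

lemma poly_val_zero [simp]: "poly_val h \<sigma> 0 = 0"
  by (simp add: poly_val_def)

lemma poly_val_single: "poly_val h \<sigma> (single u c) = h c * monom_val \<sigma> u"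
  by (cases "c = 0") (simp_all add: poly_val_def)

lemma poly_val_superset:
  assumes "finite S" "keys p \<subseteq> S"
  shows "poly_val h \<sigma> p = (\<Sum>u\<in>S. h (lookup p u) * monom_val \<sigma> u)"
  unfolding poly_val_def by (rule sum.mono_neutral_left) (use assms in \<open>auto simp: in_keys_iff\<close>)

lemma poly_val_add: "poly_val h \<sigma> (p + q) = poly_val h \<sigma> p + poly_val h \<sigma> q"
proof -
  let ?S = "keys p \<union> keys q"
  have "poly_val h \<sigma> x = (\<Sum>u\<in>?S. h (lookup x u) * monom_val \<sigma> u)" if "x \<in> {p, q, p + q}" for x
    by (rule poly_val_superset) (use that Poly_Mapping.keys_add[of p q] in auto)
  then show ?thesis by (simp add: lookup_add h.hom_add distrib_right sum.distrib)
qed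

lemma poly_val_mult: "poly_val h \<sigma> (p * q) = poly_val h \<sigma> p * poly_val h \<sigma> q"
  using mpoly_in_polys[of p]
proof (induction p rule: polys_induct)
  case (single u c)
  show ?case using mpoly_in_polys[of q]
  proof (induction q rule: polys_induct)
    case (single w e)
    show ?case by (simp add: mult_single poly_val_single h.hom_mult monom_val_add mult_ac)
  qed (simp add: distrib_left poly_val_add)
qed (simp add: poly_val_add distrib_right)

lemma poly_val_hom: "comm_ring_hom (poly_val h \<sigma>)"
proof
  show "poly_val h \<sigma> 1 = 1"
    using poly_val_single[of \<sigma> 0 1] by (simp)
qed (simp_all add: poly_val_add poly_val_mult)

lemma poly_val_indet [simp]: "poly_val h \<sigma> (indet v) = \<sigma> v"
  by (simp add: indet_def poly_val_single)

lemma poly_val_const [simp]: "poly_val h \<sigma> (single 0 c) = h c"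
  by (simp add: poly_val_single)

end

lemma const_hom: "comm_ring_hom (single 0 :: 'k::comm_ring_1 \<Rightarrow> 'k mpoly)"
  by standard (simp_all add: single_add mult_single)

lemma id_hom: "comm_ring_hom (\<lambda>c. c :: 'k::comm_ring_1)"
  by standard simp_all

lemma poly_val_self: "poly_val (single 0) indet p = (p :: 'k::comm_ring_1 mpoly)"
  using mpoly_in_polys[of p]
  by (induction p rule: polys_induct)
    (simp_all add: poly_val_single[OF const_hom] monom_val_indet mult_single poly_val_add[OF const_hom])

text \<open>Induction over the generators of the algebra suits claims about ring homomorphisms; the
  induction over terms is kept for arguments that handle whole monomials.\<close>

lemma polys_gen_induct [consumes 1, case_names const indet add mult]:
  assumes p: "p \<in> polys V"
    and const: "\<And>c. P (single 0 c)"
    and indet: "\<And>v. v \<in> V \<Longrightarrow> P (indet v)"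
    and add: "\<And>p q. p \<in> polys V \<Longrightarrow> q \<in> polys V \<Longrightarrow> P p \<Longrightarrow> P q \<Longrightarrow> P (p + q)"
    and mult: "\<And>p q. p \<in> polys V \<Longrightarrow> q \<in> polys V \<Longrightarrow> P p \<Longrightarrow> P q \<Longrightarrow> P (p * q)"
  shows "P (p :: 'k::comm_ring_1 mpoly)"
  using p
proof (induction p rule: polys_induct)
  case (single u c)
  have one: "P 1" using const[of 1] by simp
  have pow: "P (indet v ^ e) \<and> indet v ^ e \<in> (polys V :: 'k mpoly set)" if "v \<in> V" for v e
    using that by (induction e) (auto intro: mult indet one)
  have "P (\<Prod>v\<in>S. indet v ^ lookup u v) \<and> (\<Prod>v\<in>S. indet v ^ lookup u v) \<in> (polys V :: 'k mpoly set)"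
    if "finite S" "S \<subseteq> V" for S
    using that by (induction S rule: finite_induct) (auto intro: mult one simp: pow)
  then have "P (single 0 c * monom_val indet u)"
    using single by (auto simp: monom_val_def intro!: mult const)
  then show ?case by (simp add: monom_val_indet mult_single)
qed (rule add)

lemma poly_val_in_polys:
  assumes "p \<in> polys W" "\<And>v. v \<in> W \<Longrightarrow> \<theta> v \<in> polys V"
  shows "poly_val (single 0) \<theta> p \<in> (polys V :: 'k::comm_ring_1 mpoly set)"
  using assms(1)
  by (induction p rule: polys_gen_induct)
    (auto simp: poly_val_add[OF const_hom] poly_val_mult[OF const_hom]
      poly_val_indet[OF const_hom] poly_val_const[OF const_hom] assms(2))

subsection \<open>Polynomials in one distinguished indeterminate\<close>

text \<open>This is the identification of \<open>K[V, y]\<close> with \<open>K[V][y]\<close>. The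
  coefficients keep the type of all polynomials; that \<open>y\<close> has left them is recorded by
  \<open>coeff_to_univ_in_polys\<close>.\<close>

definition to_univ :: "nat \<times> nat \<Rightarrow> 'k::comm_ring_1 mpoly \<Rightarrow> 'k mpoly poly" where
  "to_univ y = poly_val (\<lambda>c. [:single 0 c:]) (\<lambda>v. if v = y then [:0, 1:] else [:indet v:])"

lemma pconst_hom: "comm_ring_hom (\<lambda>c. [:single 0 c:] :: 'k::comm_ring_1 mpoly poly)"
  by standard (simp_all add: single_add mult_single one_pCons mult.commute)

lemma to_univ_simps:
  "to_univ y (p + q) = to_univ y p + to_univ y q"
  "to_univ y (p * q) = to_univ y p * to_univ y q"
  "to_univ y (single 0 c) = [:single 0 c:]"
  "to_univ y (indet v) = (if v = y then [:0, 1:] else [:indet v:])"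
  by (simp_all add: to_univ_def poly_val_add[OF pconst_hom] poly_val_mult[OF pconst_hom]
      poly_val_indet[OF pconst_hom] poly_val_const[OF pconst_hom])

lemma to_univ_zero [simp]: "to_univ y 0 = 0"
  using to_univ_simps(3)[of y 0] by simp

lemma coeff_to_univ_in_polys:
  "p \<in> polys (insert y V) \<Longrightarrow> coeff (to_univ y p) e \<in> polys V"
proof (induction p arbitrary: e rule: polys_gen_induct)
  case (const c)
  then show ?case by (cases e) (auto simp: to_univ_simps)
next
  case (indet v)
  then show ?case by (auto simp: to_univ_simps coeff_pCons split: nat.split)
next
  case (mult p q)
  then show ?case by (auto simp: to_univ_simps coeff_mult)
qed (auto simp: to_univ_simps)

lemma poly_to_univ: "poly (to_univ y p) (indet y) = (p :: 'k::comm_ring_1 mpoly)"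
  using mpoly_in_polys[of p]
  by (induction p rule: polys_gen_induct) (simp_all add: to_univ_simps)

lemma to_univ_eq_const: "p \<in> polys V \<Longrightarrow> y \<notin> V \<Longrightarrow> to_univ y p = [:p:]"
  by (induction p rule: polys_gen_induct) (auto simp: to_univ_simps mult_ac)

lemma poly_in_polys:
  assumes "\<And>e. coeff P e \<in> polys V" "x \<in> polys V"
  shows "poly P x \<in> polys V"
  using assms(1)
proof (induction P)
  case (pCons a P)
  have "a \<in> polys V" using pCons.prems[of 0] by simp
  moreover have "poly P x \<in> polys V" using pCons.prems[of "Suc e" for e] by (intro pCons.IH) simp
  ultimately show ?case using assms(2) by auto
qed simp

lemma to_univ_eq_0_iff: "to_univ y p = 0 \<longleftrightarrow> p = 0"
  using poly_to_univ[of y p] by auto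

lemma poly_val_poly:
  assumes h: "comm_ring_hom h"
  shows "poly_val h \<sigma> (poly P x) = poly (map_poly (poly_val h \<sigma>) P) (poly_val h \<sigma> x)"
proof (induction P)
  case (pCons a P)
  then show ?case
    by (simp add: poly_val_add[OF h] poly_val_mult[OF h] map_poly_pCons poly_val_zero[OF h])
qed (simp add: poly_val_zero[OF h])

lemma poly_val_to_univ:
  assumes "comm_ring_hom h"
  shows "poly_val h \<sigma> p = poly (map_poly (poly_val h \<sigma>) (to_univ y p)) (\<sigma> y)"
  using poly_val_poly[OF assms, of \<sigma> "to_univ y p" "indet y"]
  by (simp add: poly_to_univ poly_val_indet[OF assms])

subsection \<open>Prime ideals of polynomial rings\<close>

text \<open>Negatives are multiples by \<open>- 1\<close>, so closure under sums and multiples is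
  enough. With this rule and its converse, ideals are handled through the type class
  operations.\<close>

lemma ideal_polysI:
  assumes "J \<subseteq> polys V" "0 \<in> J" "\<And>p q. p \<in> J \<Longrightarrow> q \<in> J \<Longrightarrow> p + q \<in> J"
    and mult: "\<And>p q. p \<in> polys V \<Longrightarrow> q \<in> J \<Longrightarrow> p * q \<in> J"
  shows "ideal J (poly_ring V :: 'k::comm_ring_1 mpoly ring)"
proof -
  let ?R = "poly_ring V :: 'k mpoly ring"
  interpret R: cring ?R by (rule cring_poly_ring)
  have uminus: "- p \<in> J" if "p \<in> J" for p
    using mult[of "- 1" p] that by (simp add: polys_uminus)
  have a_inv: "\<ominus>\<^bsub>?R\<^esub> p = - p" if "p \<in> polys V" for p
    using R.minus_equality[of "- p" p] that by (simp add: polys_uminus)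
  show ?thesis
  proof (rule idealI[OF R.ring_axioms])
    show "subgroup J (add_monoid ?R)"
    proof (rule R.add.subgroupI)
      show "\<ominus>\<^bsub>?R\<^esub> p \<in> J" if "p \<in> J" for p
        using that assms(1) a_inv uminus by auto
    qed (use assms in auto)
    show "p \<otimes>\<^bsub>?R\<^esub> q \<in> J" if "p \<in> J" "q \<in> carrier ?R" for p q
      using mult[of q p] that by (simp add: mult.commute)
  qed (use mult in auto)
qed

lemma ideal_polysD:
  assumes "ideal J (poly_ring V :: 'k::comm_ring_1 mpoly ring)"
  shows "J \<subseteq> polys V" "0 \<in> J" "p \<in> J \<Longrightarrow> q \<in> J \<Longrightarrow> p + q \<in> J"
    and "p \<in> polys V \<Longrightarrow> q \<in> J \<Longrightarrow> p * q \<in> J"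
    and "q \<in> J \<Longrightarrow> p \<in> polys V \<Longrightarrow> q * p \<in> J"
    and "p \<in> J \<Longrightarrow> - p \<in> J" and "p \<in> J \<Longrightarrow> q \<in> J \<Longrightarrow> p - q \<in> J"
proof -
  interpret ideal J "poly_ring V :: 'k mpoly ring" by (rule assms)
  show "J \<subseteq> polys V" using a_subset by simp
  show "0 \<in> J" using additive_subgroup.zero_closed[OF is_additive_subgroup] by simp
  show add: "p + q \<in> J" if "p \<in> J" "q \<in> J" for p q
    using additive_subgroup.a_closed[OF is_additive_subgroup that] by simp
  show mult: "p * q \<in> J" if "p \<in> polys V" "q \<in> J" for p q
    using I_l_closed[of q p] that by simp
  then show "q * p \<in> J" if "q \<in> J" "p \<in> polys V"
    using that by (simp add: mult.commute)
  show uminus: "- p \<in> J" if "p \<in> J" for p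
    using mult[of "- 1" p] that by (simp add: polys_uminus)
  show "p - q \<in> J" if "p \<in> J" "q \<in> J"
    using add[of p "- q"] uminus that by simp
qed

lemma ideal_sum:
  assumes "ideal J (poly_ring V)" "\<And>i. i \<in> I \<Longrightarrow> f i \<in> J"
  shows "sum f I \<in> J"
  using assms(2) by (induction I rule: infinite_finite_induct) (auto intro: ideal_polysD[OF assms(1)])

lemma ideal_poly:
  assumes J: "ideal J (poly_ring V)" and "\<And>e. coeff P e \<in> J" and x: "x \<in> polys V"
  shows "poly P x \<in> J"
  using assms(2)
proof (induction P)
  case (pCons a P)
  have "a \<in> J" using pCons.prems[of 0] by simp
  moreover have "poly P x \<in> J" using pCons.prems[of "Suc e" for e] by (intro pCons.IH) simp
  ultimately show ?case using ideal_polysD(3,4)[OF J] x by simp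
qed (simp add: ideal_polysD[OF J])

lemma primeideal_polysI:
  assumes "ideal P (poly_ring V :: 'k::comm_ring_1 mpoly ring)" "1 \<notin> P"
    and "\<And>p q. p \<in> polys V \<Longrightarrow> q \<in> polys V \<Longrightarrow> p * q \<in> P \<Longrightarrow> p \<in> P \<or> q \<in> P"
  shows "primeideal P (poly_ring V)"
  by (rule primeidealI) (use assms cring_poly_ring in auto)

lemma primeideal_polysD:
  assumes "primeideal P (poly_ring V :: 'k::comm_ring_1 mpoly ring)"
  shows "ideal P (poly_ring V)" "1 \<notin> P"
    and "p \<in> polys V \<Longrightarrow> q \<in> polys V \<Longrightarrow> p * q \<in> P \<Longrightarrow> p \<in> P \<or> q \<in> P"
proof -
  interpret primeideal P "poly_ring V :: 'k mpoly ring" by (rule assms)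
  show "ideal P (poly_ring V)" by (rule ideal_axioms)
  show "1 \<notin> P" using one_imp_carrier I_notcarr by auto
  show "p \<in> P \<or> q \<in> P" if "p \<in> polys V" "q \<in> polys V" "p * q \<in> P"
    using I_prime[of p q] that by simp
qed

lemma primeideal_contract:
  assumes P: "primeideal P (poly_ring W :: 'k::comm_ring_1 mpoly ring)" and "V \<subseteq> W"
  shows "primeideal (P \<inter> polys V) (poly_ring V)"
proof -
  note D = primeideal_polysD[OF P]
  note I = ideal_polysD[OF D(1)]
  have VW: "polys V \<subseteq> (polys W :: 'k mpoly set)" by (rule polys_mono[OF \<open>V \<subseteq> W\<close>])
  show ?thesis
  proof (intro primeideal_polysI ideal_polysI)
    show "p \<in> P \<inter> polys V \<or> q \<in> P \<inter> polys V"
      if "p \<in> polys V" "q \<in> polys V" "p * q \<in> P \<inter> polys V" for p q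
      using that D(3)[of p q] VW by blast
  qed (use VW D(2) I(2-4) in auto)
qed

text \<open>For \<open>y \<notin> V\<close> this is the extension of \<open>Q\<close> to
  \<open>K[V][y]\<close>. Describing it by coefficients instead of generators makes both its
  contraction to \<open>K[V]\<close> and its primality easy to read off.\<close>

definition ideal_extend :: "nat \<times> nat \<Rightarrow> (nat \<times> nat) set \<Rightarrow> 'k::comm_ring_1 mpoly set \<Rightarrow> 'k mpoly set" where
  "ideal_extend y V Q = {p \<in> polys (insert y V). \<forall>e. coeff (to_univ y p) e \<in> Q}"

lemma ideal_ideal_extend:
  assumes "ideal Q (poly_ring V)"
  shows "ideal (ideal_extend y V Q) (poly_ring (insert y V))"
proof -
  note I = ideal_polysD[OF assms]
  show ?thesis
  proof (rule ideal_polysI)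
    show "p * q \<in> ideal_extend y V Q" if "p \<in> polys (insert y V)" "q \<in> ideal_extend y V Q" for p q
      using that unfolding ideal_extend_def
      by (auto simp: to_univ_simps coeff_mult intro!: ideal_sum[OF assms] I(4) coeff_to_univ_in_polys)
  qed (auto simp: ideal_extend_def to_univ_simps intro: I)
qed

lemma ideal_extend_iff:
  "p \<in> polys V \<Longrightarrow> y \<notin> V \<Longrightarrow> 0 \<in> Q \<Longrightarrow> p \<in> ideal_extend y V Q \<longleftrightarrow> p \<in> Q"
  using polys_mono[of V "insert y V"]
  by (auto simp: ideal_extend_def to_univ_eq_const coeff_pCons split: nat.splits dest: spec[of _ 0])

lemma primeideal_ideal_extend:
  assumes Q: "primeideal Q (poly_ring V :: 'k::comm_ring_1 mpoly ring)" and y: "y \<notin> V"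
  shows "primeideal (ideal_extend y V Q) (poly_ring (insert y V))"
proof -
  note D = primeideal_polysD[OF Q]
  note I = ideal_polysD[OF D(1)]
  show ?thesis
  proof (rule primeideal_polysI[OF ideal_ideal_extend[OF D(1)]])
    show "1 \<notin> ideal_extend y V Q"
      using ideal_extend_iff[of 1 V y Q] y I(2) D(2) by auto
    fix p q :: "'k mpoly"
    assume p: "p \<in> polys (insert y V)" and q: "q \<in> polys (insert y V)"
      and pq: "p * q \<in> ideal_extend y V Q"
    let ?P = "to_univ y p" and ?R = "to_univ y q"
    show "p \<in> ideal_extend y V Q \<or> q \<in> ideal_extend y V Q"
    proof (rule ccontr)
      assume "\<not> ?thesis"
      then have ex: "\<exists>e. coeff ?P e \<notin> Q" "\<exists>e. coeff ?R e \<notin> Q"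
        using p q unfolding ideal_extend_def by blast+
      \<comment> \<open>As in Gauss's lemma, take the lowest coefficients outside \<open>Q\<close>:
        in the coefficient of degree \<open>i + j\<close> of the product, every summand except one
        has a factor in \<open>Q\<close>.\<close>
      define i where "i = (LEAST e. coeff ?P e \<notin> Q)"
      define j where "j = (LEAST e. coeff ?R e \<notin> Q)"
      have i: "coeff ?P i \<notin> Q" "\<And>e. e < i \<Longrightarrow> coeff ?P e \<in> Q"
        unfolding i_def using LeastI_ex[OF ex(1)] by (blast dest: not_less_Least)+
      have j: "coeff ?R j \<notin> Q" "\<And>e. e < j \<Longrightarrow> coeff ?R e \<in> Q"
        unfolding j_def using LeastI_ex[OF ex(2)] by (blast dest: not_less_Least)+
      have cP: "coeff ?P e \<in> polys V" and cR: "coeff ?R e \<in> polys V" for e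
        using p q by (auto intro: coeff_to_univ_in_polys)
      let ?f = "\<lambda>e. coeff ?P e * coeff ?R (i + j - e)"
      have "(\<Sum>e\<le>i + j. ?f e) \<in> Q"
        using pq by (simp add: ideal_extend_def to_univ_simps flip: coeff_mult)
      moreover have "(\<Sum>e\<le>i + j. ?f e) = ?f i + (\<Sum>e\<in>{..i + j} - {i}. ?f e)"
        by (intro sum.remove) auto
      moreover have "(\<Sum>e\<in>{..i + j} - {i}. ?f e) \<in> Q"
      proof (rule ideal_sum[OF D(1)])
        fix e assume e: "e \<in> {..i + j} - {i}"
        show "?f e \<in> Q"
        proof (cases "e < i")
          case False
          then have "i + j - e < j" using e by auto
          then show ?thesis by (intro I(4) cP j)
        qed (intro I(5) i cR)
      qed
      ultimately have "?f i \<in> Q"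
        using I(7)[of "\<Sum>e\<le>i + j. ?f e" "\<Sum>e\<in>{..i + j} - {i}. ?f e"] by simp
      then show False using D(3)[OF cP cR] i j by auto
    qed
  qed
qed

subsection \<open>Chains of prime ideals below a given one\<close>

definition prime_chain :: "(nat \<times> nat) set \<Rightarrow> nat \<Rightarrow> (nat \<Rightarrow> 'k::comm_ring_1 mpoly set) \<Rightarrow> bool" where
  "prime_chain V l Q \<longleftrightarrow> (\<forall>i\<le>l. primeideal (Q i) (poly_ring V)) \<and> (\<forall>i<l. Q i \<subset> Q (Suc i))"

lemma prime_chain_ideal_extend:
  assumes "prime_chain V l Q" "y \<notin> V"
  shows "prime_chain (insert y V) l (\<lambda>i. ideal_extend y V (Q i))"
  unfolding prime_chain_def
proof (intro conjI allI impI)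
  fix i assume i: "i < l"
  then have *: "primeideal (Q i) (poly_ring V)" "primeideal (Q (Suc i)) (poly_ring V)" "Q i \<subset> Q (Suc i)"
    using assms by (auto simp: prime_chain_def)
  note I = ideal_polysD[OF primeideal_polysD(1)[OF *(1)]] ideal_polysD[OF primeideal_polysD(1)[OF *(2)]]
  obtain q where q: "q \<in> Q (Suc i)" "q \<notin> Q i" using * by auto
  then have "q \<in> ideal_extend y V (Q (Suc i)) \<and> q \<notin> ideal_extend y V (Q i)"
    using ideal_extend_iff[of q V y] I assms(2) by auto
  then show "ideal_extend y V (Q i) \<subset> ideal_extend y V (Q (Suc i))"
    using *(3) by (auto simp: ideal_extend_def)
qed (use assms in \<open>auto simp: prime_chain_def intro: primeideal_ideal_extend\<close>)

text \<open>The set \<open>B\<close> is a transcendence basis of the residue ring modulo \<open>P\<close> that consists of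
  indeterminates.\<close>

lemma prime_chain_exists:
  assumes "finite V" "primeideal P (poly_ring V :: 'k::field mpoly ring)"
  shows "\<exists>B l Q. B \<subseteq> V \<and> polys B \<inter> P = {0} \<and> l + card B = card V \<and> prime_chain V l Q \<and> Q l = P"
  using assms
proof (induction V arbitrary: P rule: finite_induct)
  case empty
  note D = primeideal_polysD[OF empty]
  note I = ideal_polysD[OF D(1)]
  have "p = 0" if "p \<in> P" for p
  proof -
    have "p \<in> polys {}" using that I by auto
    then have "p = single 0 (lookup p 0)" by (rule polys_empty)
    then have "single 0 (inverse (lookup p 0)) * p = 1 \<or> p = 0"
      by (metis left_inverse mult_single single_one single_zero add_0)
    then show ?thesis using I(4)[of "single 0 (inverse (lookup p 0))" p] that D(2) by auto
  qed
  then have "polys {} \<inter> P = {0}" using I(2) by auto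
  then show ?case using empty
    by (intro exI[of _ "{}"] exI[of _ 0] exI[of _ "\<lambda>_. P"]) (auto simp: prime_chain_def)
next
  case (insert y V)
  note D = primeideal_polysD[OF insert.prems]
  note I = ideal_polysD[OF D(1)]
  let ?P = "P \<inter> polys V"
  have P0: "primeideal ?P (poly_ring V)"
    by (rule primeideal_contract[OF insert.prems]) auto
  obtain B l Q where B: "B \<subseteq> V" "polys B \<inter> ?P = {0}" "l + card B = card V" "prime_chain V l Q" "Q l = ?P"
    using insert.IH[OF P0] by blast
  have ch: "prime_chain (insert y V) l (\<lambda>i. ideal_extend y V (Q i))"
    by (rule prime_chain_ideal_extend) (use B insert in auto)
  have sub: "ideal_extend y V ?P \<subseteq> P"
  proof
    fix p assume "p \<in> ideal_extend y V ?P"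
    then have "poly (to_univ y p) (indet y) \<in> P"
      by (intro ideal_poly[OF D(1)]) (auto simp: ideal_extend_def)
    then show "p \<in> P" by (simp add: poly_to_univ)
  qed
  have polysB: "polys B \<inter> P = {0}"
    using B(1,2) polys_mono[of B V] by auto
  \<comment> \<open>If \<open>P\<close> is extended from its contraction, then \<open>y\<close> is
    transcendental modulo \<open>P\<close> and joins \<open>B\<close>, while the chain keeps its
    length. Otherwise the extension lies strictly below \<open>P\<close> and gives one more link,
    while \<open>B\<close> stays.\<close>
  show ?case
  proof (cases "ideal_extend y V ?P = P")
    case True
    have "p = 0" if "p \<in> polys (insert y B)" "p \<in> P" for p
    proof -
      have "coeff (to_univ y p) e \<in> polys B \<inter> ?P" for e
        using that coeff_to_univ_in_polys[of p y B e] True by (auto simp: ideal_extend_def)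
      then have "to_univ y p = 0" using B(2) by (auto simp: poly_eq_iff)
      then show ?thesis by (simp add: to_univ_eq_0_iff)
    qed
    then have "polys (insert y B) \<inter> P = {0}" using I(2) by auto
    moreover have "card (insert y B) = Suc (card B)"
      using B(1) insert.hyps by (auto intro!: card_insert_disjoint intro: finite_subset)
    ultimately show ?thesis
      using B ch True insert.hyps
      by (intro exI[of _ "insert y B"] exI[of _ l] exI[of _ "\<lambda>i. ideal_extend y V (Q i)"]) auto
  next
    case False
    let ?Q = "\<lambda>i. if i \<le> l then ideal_extend y V (Q i) else P"
    have "prime_chain (insert y V) (Suc l) ?Q"
      unfolding prime_chain_def
    proof (intro conjI allI impI)
      fix i assume "i < Suc l"
      then show "?Q i \<subset> ?Q (Suc i)"
        using ch sub False B(5) by (cases "i = l") (auto simp: prime_chain_def)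
    qed (use ch insert.prems in \<open>auto simp: prime_chain_def\<close>)
    then show ?thesis
      using B(1,3) polysB insert.hyps
      by (intro exI[of _ B] exI[of _ "Suc l"] exI[of _ ?Q]) auto
  qed
qed

text \<open>An ideal that is maximal among those disjoint from a multiplicatively closed set is
  prime. The set here consists of the nonzero polynomials in \<open>B\<close>, and it is closed
  because the coefficients form a domain.\<close>

lemma primeideal_avoiding:
  assumes J: "ideal J (poly_ring V :: 'k::idom mpoly ring)" and "polys B \<inter> J = {0}" "B \<subseteq> V"
  obtains P where "primeideal P (poly_ring V)" "J \<subseteq> P" "polys B \<inter> P = {0}"
proof -
  define A where "A = {I. ideal I (poly_ring V) \<and> J \<subseteq> I \<and> polys B \<inter> I = {0}}"
  have "\<exists>M\<in>A. \<forall>X\<in>A. M \<subseteq> X \<longrightarrow> X = M"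
  proof (rule subset_Zorn_nonempty)
    show "A \<noteq> {}" using assms by (auto simp: A_def)
    fix C assume C: "C \<noteq> {}" "subset.chain A C"
    have mem: "X \<in> A" if "X \<in> C" for X using C that by (auto simp: subset.chain_def)
    then have *: "ideal X (poly_ring V)" "J \<subseteq> X" "polys B \<inter> X = {0}" if "X \<in> C" for X
      using that by (auto simp: A_def)
    note I = ideal_polysD[OF *(1)]
    have add: "p + q \<in> \<Union>C" if pq: "p \<in> \<Union>C" "q \<in> \<Union>C" for p q
    proof -
      obtain X Y where XY: "p \<in> X" "q \<in> Y" "X \<in> C" "Y \<in> C" using pq by auto
      then have "X \<subseteq> Y \<or> Y \<subseteq> X" using C(2) by (auto simp: subset.chain_def)
      then show ?thesis using XY I(3) by blast
    qed
    have "ideal (\<Union>C) (poly_ring V)"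
    proof (rule ideal_polysI)
      show "0 \<in> \<Union>C" using C(1) I(2) by auto
      show "\<Union>C \<subseteq> polys V" using I(1) by blast
      show "p * q \<in> \<Union>C" if "p \<in> polys V" "q \<in> \<Union>C" for p q
        using that I(4) by blast
    qed (rule add)
    moreover have "J \<subseteq> \<Union>C" using *(2) C(1) by blast
    moreover have "polys B \<inter> \<Union>C = {0}" using *(3) C(1) by blast
    ultimately show "\<Union>C \<in> A" by (simp add: A_def)
  qed
  then obtain M where "M \<in> A" and max: "\<And>X. X \<in> A \<Longrightarrow> M \<subseteq> X \<Longrightarrow> X = M" by blast
  then have M: "ideal M (poly_ring V)" "J \<subseteq> M" "polys B \<inter> M = {0}" by (auto simp: A_def)
  note I = ideal_polysD[OF M(1)]
  \<comment> \<open>Otherwise adjoining \<open>p\<close> to \<open>M\<close> would give a larger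
    ideal that still avoids the nonzero polynomials in \<open>B\<close>.\<close>
  have meets: "\<exists>m\<in>M. \<exists>r\<in>polys V. m + p * r \<in> polys B \<and> m + p * r \<noteq> 0"
    if p: "p \<in> polys V" "p \<notin> M" for p
  proof (rule ccontr)
    assume no: "\<not> ?thesis"
    let ?X = "{m + p * r | m r. m \<in> M \<and> r \<in> polys V}"
    have X: "m + p * r \<in> ?X" if "m \<in> M" "r \<in> polys V" for m r using that by blast
    have "ideal ?X (poly_ring V)"
    proof (rule ideal_polysI)
      show "?X \<subseteq> polys V" using I(1) p by auto
      show "0 \<in> ?X" using X[of 0 0] I(2) by simp
      show "a + b \<in> ?X" if ab: "a \<in> ?X" "b \<in> ?X" for a b
      proof -
        obtain m r n s where "m \<in> M" "r \<in> polys V" "a = m + p * r" "n \<in> M" "s \<in> polys V" "b = n + p * s"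
          using ab by blast
        then show ?thesis using X[of "m + n" "r + s"] I(3) by (auto simp: algebra_simps)
      qed
      show "a * b \<in> ?X" if ab: "a \<in> polys V" "b \<in> ?X" for a b
      proof -
        obtain m r where "m \<in> M" "r \<in> polys V" "b = m + p * r"
          using ab by blast
        then show ?thesis using ab X[of "a * m" "a * r"] I(4) by (auto simp: algebra_simps)
      qed
    qed
    moreover have "M \<subseteq> ?X" using X[of _ 0] by auto
    moreover have "0 \<in> ?X" using X[of 0 0] I(2) by simp
    then have "polys B \<inter> ?X = {0}" using no by blast
    ultimately have "?X = M" using M(2) by (intro max) (auto simp: A_def)
    then show False using X[of 0 1] I(2) p(2) by simp
  qed
  have "primeideal M (poly_ring V)"
  proof (rule primeideal_polysI[OF M(1)])
    show "1 \<notin> M"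
    proof
      assume "1 \<in> M"
      then have "(1 :: 'k mpoly) \<in> {0}" unfolding M(3)[symmetric] by simp
      then show False by simp
    qed
    fix p q :: "'k mpoly" assume pq: "p \<in> polys V" "q \<in> polys V" "p * q \<in> M"
    show "p \<in> M \<or> q \<in> M"
    proof (rule ccontr)
      assume "\<not> ?thesis"
      then obtain m r n s where
        *: "m \<in> M" "r \<in> polys V" "m + p * r \<in> polys B" "m + p * r \<noteq> 0"
           "n \<in> M" "s \<in> polys V" "n + q * s \<in> polys B" "n + q * s \<noteq> 0"
        using meets[OF pq(1)] meets[OF pq(2)] by blast
      \<comment> \<open>Each summand on the right has a factor in \<open>M\<close>, namely
        \<open>m\<close>, \<open>n\<close> or \<open>p * q\<close>.\<close>
      have "(m + p * r) * (n + q * s) = (n + q * s) * m + p * r * n + r * s * (p * q)"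
        by (simp add: algebra_simps)
      also have "\<dots> \<in> M"
        using * pq I(1) by (intro I(3)[OF I(3)[OF I(4) I(4)] I(4)]) auto
      finally have "(m + p * r) * (n + q * s) \<in> polys B \<inter> M" using * by auto
      then show False using * M(3) by auto
    qed
  qed
  then show ?thesis using M that by blast
qed

subsection \<open>Counting monomials\<close>

text \<open>Gaussian elimination: solve equation \<open>c\<close> for an unknown \<open>i\<close>
  with nonzero coefficient, substitute it into the other equations, and recover it at the
  end.\<close>

lemma homogeneous_system:
  fixes M :: "'c \<Rightarrow> 'a \<Rightarrow> 'k::field"
  assumes "finite C" "finite A" "card C < card A"
  shows "\<exists>x. (\<exists>a\<in>A. x a \<noteq> 0) \<and> (\<forall>c\<in>C. (\<Sum>a\<in>A. M c a * x a) = 0)"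
  using assms
proof (induction C arbitrary: A M rule: finite_induct)
  case empty
  then have "A \<noteq> {}" by auto
  then show ?case by (intro exI[of _ "\<lambda>_. 1"]) auto
next
  case (insert c C)
  show ?case
  proof (cases "\<forall>a\<in>A. M c a = 0")
    case True
    have "card C < card A" using insert by auto
    from insert.IH[OF insert.prems(1) this, of M] True show ?thesis by auto
  next
    case False
    then obtain i where i: "i \<in> A" "M c i \<noteq> 0" by auto
    have "finite (A - {i})" "card C < card (A - {i})" using insert i by auto
    from insert.IH[OF this, of "\<lambda>c' a. M c' a - M c' i * M c a / M c i"]
    obtain x where x: "\<exists>a\<in>A - {i}. x a \<noteq> 0"
      and eq: "\<And>c'. c' \<in> C \<Longrightarrow> (\<Sum>a\<in>A - {i}. (M c' a - M c' i * M c a / M c i) * x a) = 0" by blast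
    define s where "s = (\<Sum>a\<in>A - {i}. M c a * x a)"
    define z where "z = x(i := - s / M c i)"
    have split: "(\<Sum>a\<in>A. M c' a * z a) = M c' i * (- s / M c i) + (\<Sum>a\<in>A - {i}. M c' a * x a)" for c'
    proof -
      have "(\<Sum>a\<in>A. M c' a * z a) = M c' i * z i + (\<Sum>a\<in>A - {i}. M c' a * z a)"
        using insert.prems i by (intro sum.remove) auto
      also have "(\<Sum>a\<in>A - {i}. M c' a * z a) = (\<Sum>a\<in>A - {i}. M c' a * x a)"
        by (intro sum.cong) (auto simp: z_def)
      finally show ?thesis by (simp add: z_def)
    qed
    have "(\<Sum>a\<in>A. M c' a * z a) = 0" if "c' \<in> C" for c'
    proof -
      have "(\<Sum>a\<in>A - {i}. M c' a * x a) - M c' i / M c i * s = 0"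
        using eq[OF that]
        by (simp add: s_def left_diff_distrib sum_subtractf sum_distrib_left mult.assoc)
      then show ?thesis using split[of c'] by simp
    qed
    moreover have "(\<Sum>a\<in>A. M c a * z a) = 0"
      using split[of c] i by (simp add: s_def)
    moreover have "\<exists>a\<in>A. z a \<noteq> 0" using x by (auto simp: z_def)
    ultimately show ?thesis by auto
  qed
qed

text \<open>Bounding each exponent rather than the degree makes the count for finite
  \<open>W\<close> exactly \<open>(e + 1) ^ card W\<close>.\<close>

definition box :: "(nat \<times> nat) set \<Rightarrow> nat \<Rightarrow> (nat \<times> nat \<Rightarrow>\<^sub>0 nat) set" where
  "box W e = {u. keys u \<subseteq> W \<and> (\<forall>v. lookup u v \<le> e)}"

lemma
  assumes "finite W"
  shows finite_box: "finite (box W e)" and card_box: "card (box W e) = (e + 1) ^ card W"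
proof -
  let ?f = "\<lambda>u. restrict (lookup u) W"
  have "bij_betw ?f (box W e) (W \<rightarrow>\<^sub>E {..e})"
    unfolding bij_betw_def
  proof
    show "inj_on ?f (box W e)"
    proof (rule inj_onI)
      fix u w assume uw: "u \<in> box W e" "w \<in> box W e" "?f u = ?f w"
      show "u = w"
      proof (rule poly_mapping_eqI)
        fix v show "lookup u v = lookup w v"
        proof (cases "v \<in> W")
          case True
          then show ?thesis using fun_cong[OF uw(3), of v] by simp
        next
          case False
          then have "v \<notin> keys u" "v \<notin> keys w" using uw by (auto simp: box_def)
          then show ?thesis by (simp add: in_keys_iff)
        qed
      qed
    qed
    show "?f ` box W e = (W \<rightarrow>\<^sub>E {..e})"
    proof
      show "(W \<rightarrow>\<^sub>E {..e}) \<subseteq> ?f ` box W e"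
      proof
        fix g assume g: "g \<in> W \<rightarrow>\<^sub>E {..e}"
        define u where "u = (\<Sum>v\<in>W. single v (g v))"
        have u: "lookup u v = (if v \<in> W then g v else 0)" for v
          using assms by (simp add: u_def lookup_sum lookup_single when_def)
        have "keys u \<subseteq> W" by (auto simp: in_keys_iff u split: if_splits)
        moreover have "lookup u v \<le> e" for v
          using PiE_mem[OF g, of v] by (cases "v \<in> W") (simp_all add: u)
        ultimately have "u \<in> box W e" by (simp add: box_def)
        moreover have "?f u = g" using PiE_arb[OF g] by (intro ext) (simp add: u restrict_def)
        ultimately show "g \<in> ?f ` box W e" by blast
      qed
    qed (auto simp: box_def)
  qed
  then show "finite (box W e)" "card (box W e) = (e + 1) ^ card W"
    using assms bij_betw_finite[of ?f "box W e" "W \<rightarrow>\<^sub>E {..e}"] bij_betw_same_card[of ?f "box W e" "W \<rightarrow>\<^sub>E {..e}"]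
    by (auto simp: card_funcsetE finite_PiE)
qed

text \<open>The hypotheses say that the residue ring of \<open>K[\<theta> v : v \<in> W]\<close> modulo \<open>J\<close> grows like a
  polynomial of degree \<open>D < |W|\<close>.\<close>

lemma algebraic_dependence:
  fixes J :: "'k::field mpoly set" and \<theta> :: "nat \<times> nat \<Rightarrow> 'k mpoly"
  assumes W: "finite W" "D < card W"
    and J: "0 \<in> J" "\<And>p q. p \<in> J \<Longrightarrow> q \<in> J \<Longrightarrow> p + q \<in> J" "\<And>c p. p \<in> J \<Longrightarrow> single 0 c * p \<in> J"
    and C: "\<And>e. finite (C e)" "\<And>e. card (C e) \<le> \<kappa> * (e + 1) ^ D"
    and red: "\<And>e u. u \<in> box W e \<Longrightarrow> \<exists>q. keys q \<subseteq> C e \<and> monom_val \<theta> u - q \<in> J"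
  obtains G where "G \<in> polys W" "G \<noteq> 0" "poly_val (single 0) \<theta> G \<in> J"
proof -
  \<comment> \<open>The exponent bound is chosen equal to the constant \<open>\<kappa>\<close> of
    the growth condition, since
    \<open>\<kappa> * (\<kappa> + 1) ^ D < (\<kappa> + 1) ^ (D + 1)\<close>.\<close>
  let ?A = "box W \<kappa>"
  have fin: "finite ?A" by (rule finite_box[OF W(1)])
  have "card (C \<kappa>) \<le> \<kappa> * (\<kappa> + 1) ^ D" by (rule C)
  also have "\<dots> < (\<kappa> + 1) ^ Suc D" by simp
  also have "\<dots> \<le> (\<kappa> + 1) ^ card W" using W by (intro power_increasing) auto
  also have "\<dots> = card ?A" by (simp add: card_box W)
  finally have card: "card (C \<kappa>) < card ?A" .
  obtain q where q: "\<And>u. u \<in> ?A \<Longrightarrow> keys (q u) \<subseteq> C \<kappa> \<and> monom_val \<theta> u - q u \<in> J"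
    using bchoice[of ?A "\<lambda>u q. keys q \<subseteq> C \<kappa> \<and> monom_val \<theta> u - q \<in> J"] red by blast
  \<comment> \<open>There are more monomials than possible terms of their representatives, so some
    nontrivial combination of the representatives cancels; the same combination of the monomials
    then lies in \<open>J\<close>.\<close>
  obtain x where x: "\<exists>u\<in>?A. x u \<noteq> 0" and eq: "\<And>c. c \<in> C \<kappa> \<Longrightarrow> (\<Sum>u\<in>?A. lookup (q u) c * x u) = 0"
    using homogeneous_system[OF C(1) fin card, of "\<lambda>c u. lookup (q u) c"] by blast
  define G where "G = (\<Sum>u\<in>?A. single u (x u))"
  have "lookup G u = x u" if "u \<in> ?A" for u
    using that fin by (simp add: G_def lookup_sum lookup_single when_def)
  then have "G \<noteq> 0" using x by auto
  have "G \<in> polys W" unfolding G_def by (intro polys_sum polys_single) (auto simp: box_def)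
  have lookup_const_mult: "lookup (single 0 c * p) w = c * lookup p w" for c w and p :: "'k mpoly"
    using mpoly_in_polys[of p]
    by (induction p rule: polys_induct)
      (auto simp: mult_single lookup_single when_def distrib_left lookup_add)
  have "(\<Sum>u\<in>?A. single 0 (x u) * q u) = 0"
  proof (rule poly_mapping_eqI)
    fix c
    have "(\<Sum>u\<in>?A. x u * lookup (q u) c) = 0"
    proof (cases "c \<in> C \<kappa>")
      case True then show ?thesis using eq[of c] by (simp add: mult.commute)
    next
      case False
      then have "lookup (q u) c = 0" if "u \<in> ?A" for u using q[OF that] by (auto simp: in_keys_iff)
      then show ?thesis by simp
    qed
    then show "lookup (\<Sum>u\<in>?A. single 0 (x u) * q u) c = lookup 0 c"
      by (simp add: lookup_sum lookup_const_mult)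
  qed
  interpret v: comm_ring_hom "poly_val (single 0) \<theta>" by (rule poly_val_hom[OF const_hom])
  have "poly_val (single 0) \<theta> G = (\<Sum>u\<in>?A. single 0 (x u) * monom_val \<theta> u)"
    by (simp add: G_def v.hom_sum poly_val_single[OF const_hom])
  also have "\<dots> = (\<Sum>u\<in>?A. single 0 (x u) * (monom_val \<theta> u - q u))"
    using \<open>(\<Sum>u\<in>?A. single 0 (x u) * q u) = 0\<close> by (simp add: right_diff_distrib sum_subtractf)
  also have "\<dots> \<in> J"
  proof -
    have "(\<Sum>u\<in>S. single 0 (x u) * (monom_val \<theta> u - q u)) \<in> J" if "S \<subseteq> ?A" for S
      using finite_subset[OF that fin] that
      by (induction S rule: finite_induct) (simp_all add: J q)
    then show ?thesis by simp
  qed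
  finally show ?thesis using that \<open>G \<noteq> 0\<close> \<open>G \<in> polys W\<close> by blast
qed

subsection \<open>An upper bound for the length of chains of prime ideals\<close>

lemma keys_mult_box:
  assumes "keys p \<subseteq> box V i" "keys q \<subseteq> box V j"
  shows "keys (p * q) \<subseteq> box V (i + j)"
proof
  fix u assume "u \<in> keys (p * q)"
  then obtain w x where u: "u = w + x" "w \<in> keys p" "x \<in> keys q"
    using subsetD[OF Poly_Mapping.keys_mult] by blast
  then have wx: "w \<in> box V i" "x \<in> box V j" using assms by auto
  then show "u \<in> box V (i + j)"
    using Poly_Mapping.keys_add[of w x] unfolding u(1) box_def
    by (auto simp: lookup_add intro: add_mono)
qed

lemma keys_power_box: "keys p \<subseteq> box V i \<Longrightarrow> keys (p ^ e) \<subseteq> box V (i * e)"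
proof (induction e)
  case (Suc e)
  then show ?case using keys_mult_box[of p V i "p ^ e" "i * e"] by (simp add: algebra_simps)
qed (simp add: box_def)

lemma keys_prod_box:
  assumes "finite S" "\<And>v. v \<in> S \<Longrightarrow> keys (f v) \<subseteq> box V i"
  shows "keys (\<Prod>v\<in>S. f v) \<subseteq> box V (card S * i)"
  using assms
proof (induction S rule: finite_induct)
  case (insert v S)
  then show ?case using keys_mult_box[of "f v" V i "\<Prod>v\<in>S. f v" "card S * i"] by simp
qed (simp add: box_def)

lemma box_mono: "i \<le> j \<Longrightarrow> box V i \<subseteq> box V j"
  by (auto simp: box_def intro: order_trans)

text \<open>Counting replaces the transcendence degree: after substitution, monomials with exponents
  at most \<open>e\<close> live in a box over \<open>V\<close> whose size grows like
  \<open>e ^ card V\<close>, so \<open>algebraic_dependence\<close> applies with the zero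
  ideal.\<close>

lemma algebraic_independence_card:
  fixes \<theta> :: "nat \<times> nat \<Rightarrow> 'k::field mpoly"
  assumes "finite V" "finite W" "\<And>v. v \<in> W \<Longrightarrow> \<theta> v \<in> polys V"
    and indep: "\<And>G. G \<in> polys W \<Longrightarrow> poly_val (single 0) \<theta> G = 0 \<Longrightarrow> G = 0"
  shows "card W \<le> card V"
proof (rule ccontr)
  assume "\<not> card W \<le> card V"
  then have less: "card V < card W" by simp
  \<comment> \<open>These are the finitely many exponents that occur in the polynomials
    \<open>\<theta> v\<close>. With \<open>\<delta>\<close> bounding them, a product of
    \<open>card W\<close> powers, each with exponent at most \<open>e\<close>, has exponents at most
    \<open>card W * (\<delta> * e)\<close>.\<close>
  let ?S = "\<Union>v\<in>W. \<Union>u\<in>keys (\<theta> v). lookup u ` keys u"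
  have "finite ?S" using assms(2) by auto
  then obtain \<delta> where \<delta>: "\<And>s. s \<in> ?S \<Longrightarrow> s \<le> \<delta>"
    by (meson finite_nat_set_iff_bounded_le)
  have keys\<theta>: "keys (\<theta> v) \<subseteq> box V \<delta>" if v: "v \<in> W" for v
  proof
    fix u assume u: "u \<in> keys (\<theta> v)"
    have "lookup u x \<le> \<delta>" for x
    proof (cases "x \<in> keys u")
      case True
      then have "lookup u x \<in> ?S" using u v by blast
      then show ?thesis by (rule \<delta>)
    qed (simp add: in_keys_iff)
    then show "u \<in> box V \<delta>" using assms(3)[OF v] u by (auto simp: box_def polys_def)
  qed
  let ?C = "\<lambda>e. box V (card W * (\<delta> * e))"
  have keys_monom: "keys (monom_val \<theta> u) \<subseteq> ?C e" if u: "u \<in> box W e" for u e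
  proof -
    have "monom_val \<theta> u = (\<Prod>v\<in>W. \<theta> v ^ lookup u v)"
      using u by (intro monom_val_superset assms(2)) (auto simp: box_def)
    moreover have "keys (\<theta> v ^ lookup u v) \<subseteq> box V (\<delta> * e)" if "v \<in> W" for v
    proof -
      have "box V (\<delta> * lookup u v) \<subseteq> box V (\<delta> * e)" using u by (intro box_mono mult_le_mono2) (simp add: box_def del: split_paired_All)
      then show ?thesis using keys_power_box[OF keys\<theta>[OF that]] by blast
    qed
    ultimately show ?thesis using keys_prod_box[OF assms(2), of "\<lambda>v. \<theta> v ^ lookup u v" V "\<delta> * e"] by simp
  qed
  obtain G where G: "G \<in> polys W" "G \<noteq> 0" "poly_val (single 0) \<theta> G \<in> {0}"
  proof (rule algebraic_dependence[OF assms(2) less])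
    show "card (?C e) \<le> (card W * \<delta> + 1) ^ card V * (e + 1) ^ card V" for e
    proof -
      have "card W * (\<delta> * e) + 1 \<le> (card W * \<delta> + 1) * (e + 1)" by (simp add: algebra_simps)
      then show ?thesis
        unfolding card_box[OF assms(1)] power_mult_distrib[symmetric] by (intro power_mono) auto
    qed
    show "\<exists>q. keys q \<subseteq> ?C e \<and> monom_val \<theta> u - q \<in> {0}" if "u \<in> box W e" for u e
      using keys_monom[OF that] by (intro exI[of _ "monom_val \<theta> u"]) simp
  qed (simp_all add: finite_box[OF assms(1)])
  then show False using indep by auto
qed

text \<open>Read a relation modulo \<open>Q\<close> as a polynomial in \<open>f\<close>. Modulo
  \<open>Q'\<close> only its constant coefficient survives, which is 0 by independence there; as
  \<open>Q\<close> is prime and \<open>f \<notin> Q\<close>, a factor \<open>f\<close> can be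
  cancelled, and the argument repeats with the remaining coefficients.\<close>

lemma independence_step:
  fixes Q Q' :: "'k::field mpoly set"
  assumes Q: "primeideal Q (poly_ring V)" and Q': "ideal Q' (poly_ring V)" and "Q \<subseteq> Q'"
    and f: "f \<in> Q'" "f \<notin> Q" and y: "y \<notin> W"
    and \<theta>: "\<And>v. v \<in> W \<Longrightarrow> \<theta> v \<in> polys V"
    and indep: "\<And>G. G \<in> polys W \<Longrightarrow> poly_val (single 0) \<theta> G \<in> Q' \<Longrightarrow> G = 0"
    and G: "G \<in> polys (insert y W)" "poly_val (single 0) (\<theta>(y := f)) G \<in> Q"
  shows "G = 0"
proof -
  note D = primeideal_polysD[OF Q]
  note I' = ideal_polysD[OF Q']
  define \<tau> where "\<tau> = \<theta>(y := f)"
  have val: "poly_val (single 0) \<tau> a = poly_val (single 0) \<theta> a" if "a \<in> polys W" for a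
    by (rule poly_val_cong[OF that]) (use y in \<open>auto simp: \<tau>_def\<close>)
  have fV: "f \<in> polys V" using f I'(1) by auto
  have "P = 0" if "\<And>e. coeff P e \<in> polys W" "poly (map_poly (poly_val (single 0) \<tau>) P) f \<in> Q" for P
    using that
  proof (induction P)
    case (pCons a P)
    let ?v = "poly_val (single 0) \<tau>" and ?r = "poly (map_poly (poly_val (single 0) \<tau>) P) f"
    have a: "a \<in> polys W" using pCons.prems(1)[of 0] by simp
    have P: "coeff P e \<in> polys W" for e using pCons.prems(1)[of "Suc e"] by simp
    have r: "?r \<in> polys V"
      using P fV by (intro poly_in_polys)
        (auto simp: coeff_map_poly poly_val_zero[OF const_hom] val intro!: poly_val_in_polys[where W = W] \<theta>)
    have sum: "?v a + f * ?r \<in> Q"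
      using pCons.prems(2) by (simp add: map_poly_pCons poly_val_zero[OF const_hom])
    then have "?v a + f * ?r - f * ?r \<in> Q'"
      using \<open>Q \<subseteq> Q'\<close> f(1) r by (intro I'(7) I'(5)) auto
    then have "a = 0" using indep[OF a] val[OF a] by simp
    then have "f * ?r \<in> Q" using sum by (simp add: poly_val_zero[OF const_hom])
    then have "?r \<in> Q" using D(3)[OF fV r] f(2) by auto
    then have "P = 0" using pCons.IH P by blast
    then show ?case using \<open>a = 0\<close> by simp
  qed simp
  moreover have "poly (map_poly (poly_val (single 0) \<tau>) (to_univ y G)) f \<in> Q"
    using G(2) poly_val_to_univ[OF const_hom, of \<tau> G y] by (simp add: \<tau>_def)
  ultimately have "to_univ y G = 0"
    using coeff_to_univ_in_polys[OF G(1)] by blast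
  then show ?thesis by (simp add: to_univ_eq_0_iff)
qed

lemma prime_chain_length:
  fixes Q :: "nat \<Rightarrow> 'k::field mpoly set"
  assumes V: "finite V" and ch: "prime_chain V l Q" and B: "B \<subseteq> V" "polys B \<inter> Q l = {0}"
  shows "l + card B \<le> card V"
proof -
  have "\<exists>W \<theta>. finite W \<and> card W = card B + k \<and> (\<forall>v\<in>W. \<theta> v \<in> polys V) \<and>
          (\<forall>G\<in>polys W. poly_val (single 0) \<theta> G \<in> Q (l - k) \<longrightarrow> G = 0)" if "k \<le> l" for k
    using that
  proof (induction k)
    case 0
    have "finite B" using B(1) V finite_subset by auto
    then show ?case using B
      by (intro exI[of _ B] exI[of _ indet]) (auto simp: poly_val_self)
  next
    case (Suc k)
    then obtain W \<theta> where W: "finite W" "card W = card B + k" "\<And>v. v \<in> W \<Longrightarrow> \<theta> v \<in> polys V"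
      "\<And>G. G \<in> polys W \<Longrightarrow> poly_val (single 0) \<theta> G \<in> Q (l - k) \<Longrightarrow> G = 0" by auto
    have k: "Suc (l - Suc k) = l - k" "l - Suc k < l" using Suc.prems by auto
    have prime: "primeideal (Q (l - Suc k)) (poly_ring V)" "primeideal (Q (l - k)) (poly_ring V)"
      using ch by (simp_all add: prime_chain_def)
    have "Q (l - Suc k) \<subset> Q (Suc (l - Suc k))"
      using ch k(2) unfolding prime_chain_def by blast
    then have sub: "Q (l - Suc k) \<subseteq> Q (l - k)" and "\<exists>f. f \<in> Q (l - k) \<and> f \<notin> Q (l - Suc k)"
      unfolding k(1) by auto
    then obtain f where f: "f \<in> Q (l - k)" "f \<notin> Q (l - Suc k)" by blast
    have fV: "f \<in> polys V" using f ideal_polysD(1)[OF primeideal_polysD(1)[OF prime(2)]] by auto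
    have "infinite (UNIV :: (nat \<times> nat) set)" by (simp add: finite_prod)
    then obtain y where y: "y \<notin> W" using W(1) ex_new_if_finite by blast
    show ?case
    proof (intro exI[of _ "insert y W"] exI[of _ "\<theta>(y := f)"] conjI ballI impI)
      fix G assume "G \<in> polys (insert y W)" "poly_val (single 0) (\<theta>(y := f)) G \<in> Q (l - Suc k)"
      then show "G = 0"
        by (rule independence_step[OF prime(1) primeideal_polysD(1)[OF prime(2)] sub f y W(3,4), rotated -2])
    qed (use W(1,2,3) y fV in auto)
  qed
  from this[OF order_refl] obtain W \<theta> where W: "finite W" "card W = card B + l" "\<And>v. v \<in> W \<Longrightarrow> \<theta> v \<in> polys V"
    "\<And>G. G \<in> polys W \<Longrightarrow> poly_val (single 0) \<theta> G \<in> Q 0 \<Longrightarrow> G = 0" by auto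
  \<comment> \<open>A relation that holds in the polynomial ring also holds modulo
    \<open>Q 0\<close>, so the elements are independent in the polynomial ring itself.\<close>
  have "0 \<in> Q 0" using ch ideal_polysD(2)[OF primeideal_polysD(1)] by (auto simp: prime_chain_def)
  then have "card W \<le> card V"
    by (intro algebraic_independence_card[OF V W(1,3) W(4)]) auto
  then show ?thesis using W(2) by simp
qed

subsection \<open>Minors and their antidiagonal terms\<close>

text \<open>Rows and columns are enumerated by functions with the positions counted from 1 as
  values. Permutations and Laplace expansion then act by composition, in contrast to the index sets
  of \<open>minors_in\<close>.\<close>

definition minor :: "nat \<Rightarrow> (nat \<Rightarrow> nat) \<Rightarrow> (nat \<Rightarrow> nat) \<Rightarrow> 'k::comm_ring_1 mpoly" where
  "minor s f g = det (mat s s (\<lambda>(i, j). indet (f i, g j)))"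

lemma pick_image:
  assumes "strict_mono_on {..<s} h" "i < s"
  shows "pick (h ` {..<s}) i = h i"
proof -
  have "{a \<in> h ` {..<s}. a < h i} = h ` {..<i}"
    using assms by (auto simp: strict_mono_on_less)
  moreover have "inj_on h {..<i}"
    using assms by (auto intro: inj_on_subset[OF strict_mono_on_imp_inj_on])
  ultimately have "card {a \<in> h ` {..<s}. a < h i} = i" by (simp add: card_image)
  then show ?thesis using pick_card_in_set[of "h i" "h ` {..<s}"] assms by simp
qed

lemma strict_mono_on_pick: "card A = s \<Longrightarrow> strict_mono_on {..<s} (pick A)"
  by (auto simp: strict_mono_on_def intro: pick_mono_le)

lemma submatrix_generic_matrix:
  assumes "A \<subseteq> {..<m}" "B \<subseteq> {..<n}" "card A = s" "card B = s"
  shows "submatrix (generic_matrix m n) A B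
    = mat s s (\<lambda>(i, j). indet (Suc (pick A i), Suc (pick B j)))"
proof -
  have "{i. i < m \<and> i \<in> A} = A" "{i. i < n \<and> i \<in> B} = B" using assms by auto
  moreover have "pick A i < m" "pick B i < n" if "i < s" for i
    using assms that pick_in_set_le[of i A] pick_in_set_le[of i B] by auto
  ultimately show ?thesis
    using assms by (intro eq_matI) (auto simp: submatrix_def generic_matrix_def)
qed

lemma minor_in_minors_in:
  assumes f: "strict_mono_on {..<s} f" "\<And>i. i < s \<Longrightarrow> f i \<in> {1..m}"
    and g: "strict_mono_on {..<s} g" "\<And>i. i < s \<Longrightarrow> g i \<in> {1..n}"
    and M: "\<And>i j. i < s \<Longrightarrow> j < s \<Longrightarrow> (f i, g j) \<in> M"
  shows "minor s f g \<in> minors_in m n s M"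
proof -
  define f' g' where "f' i = f i - 1" and "g' i = g i - 1" for i
  have Suc: "Suc (f' i) = f i" "Suc (g' i) = g i" if "i < s" for i
    using f(2)[OF that] g(2)[OF that] by (auto simp: f'_def g'_def)
  have mono: "strict_mono_on {..<s} f'" "strict_mono_on {..<s} g'"
    using f g Suc by (auto simp: strict_mono_on_def) (metis Suc_less_SucD order.strict_trans)+
  let ?A = "f' ` {..<s}" and ?B = "g' ` {..<s}"
  have card: "card ?A = s" "card ?B = s"
    using mono[THEN strict_mono_on_imp_inj_on] by (simp_all add: card_image)
  have sub: "?A \<subseteq> {..<m}" "?B \<subseteq> {..<n}"
    using f(2) g(2) Suc by fastforce+
  have "minor s f g = det (submatrix (generic_matrix m n) ?A ?B)"
    unfolding minor_def submatrix_generic_matrix[OF sub card]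
    by (intro arg_cong[of _ _ det] eq_matI) (simp_all add: pick_image mono Suc)
  moreover have "Suc ` ?A \<times> Suc ` ?B \<subseteq> M" using M Suc by auto
  ultimately show ?thesis unfolding minors_in_def using card sub by blast
qed

lemma minors_in_cases:
  assumes "D \<in> minors_in m n s M"
  obtains f g where "strict_mono_on {..<s} f" "\<And>i. i < s \<Longrightarrow> f i \<in> {1..m}"
    "strict_mono_on {..<s} g" "\<And>i. i < s \<Longrightarrow> g i \<in> {1..n}"
    "\<And>i j. i < s \<Longrightarrow> j < s \<Longrightarrow> (f i, g j) \<in> M" "D = minor s f g"
proof -
  obtain A B where D: "D = det (submatrix (generic_matrix m n) A B)"
    and AB: "A \<subseteq> {..<m}" "B \<subseteq> {..<n}" "card A = s" "card B = s" "Suc ` A \<times> Suc ` B \<subseteq> M"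
    using assms unfolding minors_in_def by blast
  have pick: "pick A i \<in> A" "pick B i \<in> B" if "i < s" for i
    using AB that pick_in_set_le[of i A] pick_in_set_le[of i B] by auto
  show ?thesis
  proof
    show "strict_mono_on {..<s} (\<lambda>i. Suc (pick A i))" "strict_mono_on {..<s} (\<lambda>i. Suc (pick B i))"
      using strict_mono_on_pick[of A s] strict_mono_on_pick[of B s] AB
      by (simp_all add: strict_mono_on_def)
    show "D = minor s (\<lambda>i. Suc (pick A i)) (\<lambda>i. Suc (pick B i))"
      using D AB by (simp add: minor_def submatrix_generic_matrix)
  qed (use AB pick in fastforce)+
qed

section \<open>Weights of monomials and the antidiagonal term\<close>

definition wt :: "(nat \<times> nat \<Rightarrow> nat) \<Rightarrow> (nat \<times> nat \<Rightarrow>\<^sub>0 nat) \<Rightarrow> nat" where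
  "wt \<omega> u = (\<Sum>v\<in>keys u. lookup u v * \<omega> v)"

lemma wt_superset: "finite S \<Longrightarrow> keys u \<subseteq> S \<Longrightarrow> wt \<omega> u = (\<Sum>v\<in>S. lookup u v * \<omega> v)"
  unfolding wt_def by (rule sum.mono_neutral_left) (auto simp: in_keys_iff)

lemma wt_add: "wt \<omega> (u + w) = wt \<omega> u + wt \<omega> w"
proof -
  let ?S = "keys u \<union> keys w"
  have "wt \<omega> x = (\<Sum>v\<in>?S. lookup x v * \<omega> v)" if "x \<in> {u, w, u + w}" for x
    by (rule wt_superset) (use that Poly_Mapping.keys_add[of u w] in auto)
  then show ?thesis by (simp add: lookup_add algebra_simps sum.distrib)
qed

lemma wt_single [simp]: "wt \<omega> (single v e) = e * \<omega> v"
  by (cases "e = 0") (simp_all add: wt_def)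

lemma wt_sum: "wt \<omega> (sum f I) = (\<Sum>i\<in>I. wt \<omega> (f i))"
  by (induction I rule: infinite_finite_induct) (simp_all add: wt_add, simp_all add: wt_def)

lemma lookup_le_wt: "lookup u v \<le> wt (\<lambda>_. 1) u"
  by (cases "v \<in> keys u") (auto simp: wt_def in_keys_iff intro: member_le_sum)

abbreviation line_wt :: "(nat \<times> nat \<Rightarrow>\<^sub>0 nat) \<Rightarrow> nat" where
  "line_wt \<equiv> wt (\<lambda>(r, s). (r + s)\<^sup>2)"

lemma keys_sum_single: "keys (\<Sum>i\<in>I. single (f i) (1::nat)) \<subseteq> f ` I"
  using keys_sum[of "\<lambda>i. single (f i) (1::nat)" I] by auto

text \<open>In a term of a minor whose antidiagonal lies on the line \<open>r + s = e\<close>, the deviations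
  \<open>r + s - e\<close> of the factors from that line add up to 0. Hence the sum of the \<open>(r + s)\<^sup>2\<close> is
  minimal exactly for the antidiagonal term.\<close>

lemma sum_squares_permuted:
  fixes r g :: "nat \<Rightarrow> nat"
  assumes p: "p permutes {..<t}" and g: "\<And>i. i < t \<Longrightarrow> r i + g (t - 1 - i) = e"
    and ne: "\<exists>i<t. r i + g (p i) \<noteq> e"
  shows "t * e\<^sup>2 < (\<Sum>i<t. (r i + g (p i))\<^sup>2)"
proof -
  define y where "y i = int (r i + g (p i)) - int e" for i
  have "(\<Sum>i<t. int (g (p i))) = (\<Sum>i<t. int (g i))"
    using sum.permute[OF p, of "\<lambda>i. int (g i)"] by (simp add: o_def)
  also have "\<dots> = (\<Sum>i<t. int (g (t - 1 - i)))"
    using sum.nat_diff_reindex[of "\<lambda>i. int (g i)" t] by simp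
  also have "\<dots> = (\<Sum>i<t. int e - int (r i))"
    using g by (intro sum.cong) (auto simp flip: g)
  finally have "(\<Sum>i<t. y i) = 0"
    by (simp add: y_def sum.distrib sum_subtractf)
  have "(\<Sum>i<t. int (r i + g (p i)) ^ 2) = (\<Sum>i<t. int e ^ 2 + 2 * int e * y i + y i ^ 2)"
    by (intro sum.cong) (auto simp: y_def power2_eq_square algebra_simps)
  also have "\<dots> = int t * int e ^ 2 + 2 * int e * (\<Sum>i<t. y i) + (\<Sum>i<t. y i ^ 2)"
    by (simp add: sum.distrib sum_distrib_left)
  finally have "(\<Sum>i<t. int (r i + g (p i)) ^ 2) = int (t * e\<^sup>2) + (\<Sum>i<t. y i ^ 2)"
    using \<open>(\<Sum>i<t. y i) = 0\<close> by simp
  moreover have "0 < (\<Sum>i<t. y i ^ 2)"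
  proof -
    obtain i where i: "i < t" "r i + g (p i) \<noteq> e" using ne by blast
    then have "y i \<noteq> 0" by (auto simp: y_def)
    then have "0 < y i ^ 2" by simp
    also have "\<dots> \<le> (\<Sum>i<t. y i ^ 2)" using i by (intro member_le_sum) auto
    finally show ?thesis .
  qed
  ultimately have "int (t * e\<^sup>2) < int (\<Sum>i<t. (r i + g (p i))\<^sup>2)" by simp
  then show ?thesis by (simp only: of_nat_less_iff)
qed

lemma prod_indet: "finite I \<Longrightarrow> (\<Prod>i\<in>I. indet (f i)) = (single (\<Sum>i\<in>I. single (f i) 1) 1 :: 'k::comm_ring_1 mpoly)"
  by (induction I rule: finite_induct) (simp_all add: indet_def mult_single)

text \<open>The permutation that reverses the columns contributes the product over \<open>T\<close>,
  and by \<open>sum_squares_permuted\<close> all other terms are heavier. The two alternatives for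
  the minor account for the sign of the reversal.\<close>

lemma antidiagonal_reduction:
  fixes T :: "(nat \<times> nat) set"
  assumes T: "card T = t" "t \<ge> 1" "\<And>x. x \<in> T \<Longrightarrow> fst x + snd x = e"
  obtains f g q where "strict_mono_on {..<t} f" "\<forall>i<t. f i \<in> fst ` T"
    "strict_mono_on {..<t} g" "\<forall>i<t. g i \<in> snd ` T"
    "minor t f g = single (\<Sum>x\<in>T. single x 1) 1 - q \<or> - minor t f g = single (\<Sum>x\<in>T. single x 1) 1 - (q :: 'k::comm_ring_1 mpoly)"
    "\<forall>u\<in>keys q. keys u \<subseteq> fst ` T \<times> snd ` T \<and> wt (\<lambda>_. 1) u = t \<and> line_wt u > line_wt (\<Sum>x\<in>T. single x 1)"
proof -
  have fin: "finite T" using T(1,2) by (auto intro: card_ge_0_finite)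
  have inj: "inj_on fst T" using T(3) by (auto simp: inj_on_def) (metis add_left_cancel)
  define f where "f = pick (fst ` T)"
  have cardR: "card (fst ` T) = t" using inj T(1) by (simp add: card_image)
  have f: "strict_mono_on {..<t} f" unfolding f_def by (rule strict_mono_on_pick[OF cardR])
  have fT: "f i \<in> fst ` T" if "i < t" for i
    using pick_in_set_le[of i "fst ` T"] cardR that by (simp add: f_def)
  have fT': "(f i, e - f i) \<in> T \<and> f i \<le> e" if "i < t" for i
    using fT[OF that] T(3) by force
  \<comment> \<open>On the line a row determines its column, and larger rows have smaller columns;
    reversing the index makes \<open>g\<close> increasing. The truncated subtraction is exact
    because \<open>f i \<le> e\<close>.\<close>
  define g where "g i = e - f (t - 1 - i)" for i
  have g: "strict_mono_on {..<t} g"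
  proof (rule strict_mono_onI)
    fix i j :: nat assume ij: "i \<in> {..<t}" "j \<in> {..<t}" "i < j"
    have "f (t - 1 - j) < f (t - 1 - i)" using f ij by (auto simp: strict_mono_on_def)
    moreover have "f (t - 1 - i) \<le> e" using fT' ij by simp
    ultimately show "g i < g j" unfolding g_def by linarith
  qed
  have gT: "g i \<in> snd ` T" if "i < t" for i
    using fT'[of "t - 1 - i"] that by (force simp: g_def)
  have fg: "f i + g (t - 1 - i) = e" if "i < t" for i
    using fT'[OF that] that by (simp add: g_def)
  have injf: "inj_on f {..<t}" and injg: "inj_on g {..<t}"
    using f g strict_mono_on_imp_inj_on by auto
  have Teq: "(\<lambda>i. (f i, g (t - 1 - i))) ` {..<t} = T"
  proof (rule card_subset_eq[OF fin])
    show "(\<lambda>i. (f i, g (t - 1 - i))) ` {..<t} \<subseteq> T"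
      using fT' fg by (auto) (metis diff_add_inverse)
    have "inj_on (\<lambda>i. (f i, g (t - 1 - i))) {..<t}" using injf by (auto simp: inj_on_def)
    then show "card ((\<lambda>i. (f i, g (t - 1 - i))) ` {..<t}) = card T" using T(1) by (simp add: card_image)
  qed
  define \<mu> where "\<mu> p = (\<Sum>i<t. single (f i, g (p i)) (1::nat))" for p
  define p0 where "p0 i = (if i < t then t - 1 - i else i)" for i
  have p0: "p0 permutes {..<t}"
  proof (rule bij_imp_permutes)
    show "bij_betw p0 {..<t} {..<t}"
      by (rule bij_betw_byWitness[of _ p0]) (auto simp: p0_def)
  qed (simp add: p0_def)
  have \<mu>0: "\<mu> p0 = (\<Sum>x\<in>T. single x 1)"
  proof -
    have "inj_on (\<lambda>i. (f i, g (t - 1 - i))) {..<t}" using injf by (auto simp: inj_on_def)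
    then have "(\<Sum>x\<in>T. single x (1::nat)) = (\<Sum>i<t. single (f i, g (t - 1 - i)) 1)"
      by (subst Teq[symmetric]) (simp add: sum.reindex)
    then show ?thesis by (simp add: \<mu>_def p0_def)
  qed
  let ?P = "{p. p permutes {..<t}}"
  let ?s = "\<lambda>p. signof p :: 'k mpoly"
  have det: "minor t f g = (\<Sum>p\<in>?P. ?s p * single (\<mu> p) 1)"
  proof -
    have "minor t f g = (\<Sum>p\<in>?P. ?s p * (\<Prod>i<t. indet (f i, g (p i))))"
      unfolding minor_def det_def by (auto simp: atLeast0LessThan intro!: sum.cong prod.cong dest: permutes_in_image)
    then show ?thesis by (simp add: prod_indet \<mu>_def)
  qed
  \<comment> \<open>Multiplying the determinant by the sign of \<open>p0\<close> gives the
    antidiagonal term coefficient 1; \<open>q\<close> is the negative of what remains.\<close>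
  define q where "q = - (?s p0) * (\<Sum>p\<in>?P - {p0}. ?s p * single (\<mu> p) 1)"
  have sq: "?s p0 * ?s p0 = 1" by (simp add: sign_def)
  have "?s p0 * minor t f g = single (\<mu> p0) 1 - q"
  proof -
    have "minor t f g = ?s p0 * single (\<mu> p0) 1 + (\<Sum>p\<in>?P - {p0}. ?s p * single (\<mu> p) 1)"
      unfolding det using p0 by (intro sum.remove) (auto simp: finite_permutations)
    then have "?s p0 * minor t f g = ?s p0 * ?s p0 * single (\<mu> p0) 1 - q"
      by (simp add: q_def algebra_simps)
    then show ?thesis by (simp only: sq mult_1)
  qed
  moreover have "?s p0 = 1 \<or> ?s p0 = -1" by (simp add: sign_def)
  ultimately have eq: "minor t f g = single (\<mu> p0) 1 - q \<or> - minor t f g = single (\<mu> p0) 1 - q"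
    by auto
  have keysq: "\<exists>p\<in>?P - {p0}. u = \<mu> p" if "u \<in> keys q" for u
  proof (rule ccontr)
    assume "\<not> ?thesis"
    then have "lookup (?s p * single (\<mu> p) 1) u = 0" if "p \<in> ?P - {p0}" for p
      using that by (auto simp: sign_def lookup_single when_def)
    then have "lookup (\<Sum>p\<in>?P - {p0}. ?s p * single (\<mu> p) 1) u = 0"
      by (simp add: lookup_sum)
    moreover have "- (?s p0) = 1 \<or> - (?s p0) = - 1" by (auto simp: sign_def)
    ultimately have "lookup q u = 0" unfolding q_def by (auto simp del: mult_minus_left)
    then show False using that by (simp add: in_keys_iff)
  qed
  have wts: "keys u \<subseteq> fst ` T \<times> snd ` T \<and> wt (\<lambda>_. 1) u = t \<and> line_wt u > line_wt (\<mu> p0)"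
    if u: "u \<in> keys q" for u
  proof -
    obtain p where p: "p permutes {..<t}" "p \<noteq> p0" "u = \<mu> p" using keysq[OF u] by auto
    have pt: "p i < t" if "i < t" for i using permutes_in_image[OF p(1), of i] that by simp
    have "\<exists>i<t. f i + g (p i) \<noteq> e"
    proof (rule ccontr)
      assume no: "\<not> ?thesis"
      have "p i = p0 i" for i
      proof (cases "i < t")
        case True
        have "f i + g (p i) = f i + g (t - 1 - i)" using no fg True by auto
        then have "g (p i) = g (t - 1 - i)" by simp
        then have "p i = t - 1 - i" using inj_onD[OF injg] pt[OF True] True by auto
        then show ?thesis by (simp add: p0_def True)
      next
        case False
        then show ?thesis using p(1) by (simp add: p0_def permutes_def)
      qed
      then show False using p(2) by auto
    qed
    then have "t * e\<^sup>2 < (\<Sum>i<t. (f i + g (p i))\<^sup>2)"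
      by (intro sum_squares_permuted[OF p(1)] fg)
    moreover have "line_wt (\<mu> p) = (\<Sum>i<t. (f i + g (p i))\<^sup>2)" for p
      by (simp add: \<mu>_def wt_sum)
    moreover have "(\<Sum>i<t. (f i + g (p0 i))\<^sup>2) = t * e\<^sup>2"
      using fg by (simp add: p0_def)
    moreover have "keys (\<mu> p) \<subseteq> fst ` T \<times> snd ` T"
      unfolding \<mu>_def
      by (rule order_trans[OF keys_sum_single], intro image_subsetI SigmaI) (simp_all only: lessThan_iff fT gT pt)
    moreover have "wt (\<lambda>_. 1) (\<mu> p) = t" by (simp add: \<mu>_def wt_sum)
    ultimately show ?thesis using p(3) by simp
  qed
  show ?thesis
  proof (rule that[OF f _ g])
    show "\<forall>i<t. f i \<in> fst ` T" "\<forall>i<t. g i \<in> snd ` T" using fT gT by blast+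
    show "minor t f g = single (\<Sum>x\<in>T. single x 1) 1 - q \<or> - minor t f g = single (\<Sum>x\<in>T. single x 1) 1 - q"
      using eq by (simp only: \<mu>0)
    show "\<forall>u\<in>keys q. keys u \<subseteq> fst ` T \<times> snd ` T \<and> wt (\<lambda>_. 1) u = t \<and> line_wt u > line_wt (\<Sum>x\<in>T. single x 1)"
      using wts by (simp only: \<mu>0) blast
  qed
qed

subsection \<open>Reduction to standard monomials\<close>

text \<open>The predicate \<open>F\<close> describes the supports of the standard monomials.\<close>

definition reducible_supports :: "'k::comm_ring_1 mpoly set \<Rightarrow> (nat \<times> nat) set \<Rightarrow> ((nat \<times> nat) set \<Rightarrow> bool) \<Rightarrow> bool" where
  "reducible_supports J L F \<longleftrightarrow> (\<forall>S\<subseteq>L. \<not> F S \<longrightarrow> (\<exists>T\<subseteq>S. \<exists>t e. card T = t \<and> t \<ge> 1 \<and>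
     (\<forall>x\<in>T. fst x + snd x = e) \<and> fst ` T \<times> snd ` T \<subseteq> L \<and>
     (\<forall>f g. strict_mono_on {..<t} f \<longrightarrow> (\<forall>i<t. f i \<in> fst ` T) \<longrightarrow>
        strict_mono_on {..<t} g \<longrightarrow> (\<forall>i<t. g i \<in> snd ` T) \<longrightarrow> minor t f g \<in> J)))"

lemma reduction_step:
  fixes J :: "'k::comm_ring_1 mpoly set"
  assumes J: "ideal J (poly_ring L)" and red: "reducible_supports J L F"
    and u: "keys u \<subseteq> L" "\<not> F (keys u)"
  obtains r where "single u 1 - r \<in> J"
    "\<And>v. v \<in> keys r \<Longrightarrow> keys v \<subseteq> L \<and> wt (\<lambda>_. 1) v = wt (\<lambda>_. 1) u \<and> line_wt u < line_wt v"
proof -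
  note I = ideal_polysD[OF J]
  obtain T t e where T: "T \<subseteq> keys u" "card T = t" "t \<ge> 1" "\<And>x. x \<in> T \<Longrightarrow> fst x + snd x = e"
      "fst ` T \<times> snd ` T \<subseteq> L"
    and minors: "\<forall>f g. strict_mono_on {..<t} f \<longrightarrow> (\<forall>i<t. f i \<in> fst ` T) \<longrightarrow>
        strict_mono_on {..<t} g \<longrightarrow> (\<forall>i<t. g i \<in> snd ` T) \<longrightarrow> minor t f g \<in> J"
    using red u unfolding reducible_supports_def by (elim allE[of _ "keys u"] impE exE conjE) auto
  let ?\<mu> = "\<Sum>x\<in>T. single x (1::nat)"
  obtain f g q where fg: "strict_mono_on {..<t} f" "\<forall>i<t. f i \<in> fst ` T"
    "strict_mono_on {..<t} g" "\<forall>i<t. g i \<in> snd ` T"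
    and eq: "minor t f g = single ?\<mu> 1 - q \<or> - minor t f g = single ?\<mu> 1 - (q :: 'k mpoly)"
    and q: "\<forall>u\<in>keys q. keys u \<subseteq> fst ` T \<times> snd ` T \<and> wt (\<lambda>_. 1) u = t \<and> line_wt u > line_wt ?\<mu>"
    using antidiagonal_reduction[OF T(2,3,4), where 'k = 'k] by blast
  have "finite T" using T(1) finite_subset finite_keys by blast
  \<comment> \<open>\<open>T\<close> lies in the support of \<open>u\<close>, so the product over
    \<open>T\<close> divides \<open>u\<close> and \<open>w\<close> is the true quotient. The
    relation is the minor multiplied by \<open>w\<close>.\<close>
  define w where "w = u - ?\<mu>"
  have lookup\<mu>: "lookup ?\<mu> x = (if x \<in> T then 1 else 0)" for x
    using \<open>finite T\<close> by (simp add: lookup_sum lookup_single when_def)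
  have "u = w + ?\<mu>"
  proof (rule poly_mapping_eqI)
    fix x
    have "lookup ?\<mu> x \<le> lookup u x"
      using T(1) unfolding lookup\<mu> by (cases "x \<in> T") (auto simp: in_keys_iff Suc_le_eq)
    then show "lookup u x = lookup (w + ?\<mu>) x"
      by (simp only: w_def lookup_add lookup_minus le_add_diff_inverse2)
  qed
  have "keys w \<subseteq> keys u" by (auto simp: w_def in_keys_iff lookup_minus)
  have "minor t f g \<in> J" using minors fg by blast
  then have "single ?\<mu> 1 - q \<in> J"
    using eq I(6)[of "minor t f g"] by (elim disjE) (simp_all only:)
  then have "single w 1 * (single ?\<mu> 1 - q) \<in> J"
    using \<open>keys w \<subseteq> keys u\<close> u(1) by (intro I(4) polys_single) auto
  then have "single u 1 - single w 1 * q \<in> J"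
    using \<open>u = w + ?\<mu>\<close> by (simp add: right_diff_distrib mult_single)
  moreover have "keys v \<subseteq> L \<and> wt (\<lambda>_. 1) v = wt (\<lambda>_. 1) u \<and> line_wt u < line_wt v"
    if v: "v \<in> keys (single w 1 * q)" for v
  proof -
    obtain v' where v': "v = w + v'" "v' \<in> keys q"
      using subsetD[OF Poly_Mapping.keys_mult v] by (auto split: if_splits)
    have "wt (\<lambda>_. 1) ?\<mu> = t" using T(2) by (simp add: wt_sum)
    then have "wt (\<lambda>_. 1) v = wt (\<lambda>_. 1) u"
      using bspec[OF q v'(2)] \<open>u = w + ?\<mu>\<close> v'(1) by (simp add: wt_add)
    moreover have "line_wt u < line_wt v"
      using bspec[OF q v'(2)] \<open>u = w + ?\<mu>\<close> v'(1) by (simp add: wt_add)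
    moreover have "keys v \<subseteq> L"
      using Poly_Mapping.keys_add[of w v'] bspec[OF q v'(2)] T(5) \<open>keys w \<subseteq> keys u\<close> u(1) v'(1) by blast
    ultimately show ?thesis by blast
  qed
  ultimately show ?thesis using that by blast
qed

text \<open>Each reduction keeps the total degree and strictly raises \<open>line_wt\<close>, which
  the degree bounds because \<open>L\<close> is finite. The induction is on the remaining
  gap.\<close>

lemma standard_representation:
  fixes J :: "'k::comm_ring_1 mpoly set"
  assumes "finite L" and J: "ideal J (poly_ring L)" and red: "reducible_supports J L F"
    and "keys u \<subseteq> L"
  shows "\<exists>q. keys q \<subseteq> {w. keys w \<subseteq> L \<and> F (keys w) \<and> wt (\<lambda>_. 1) w = wt (\<lambda>_. 1) u} \<and> single u 1 - q \<in> J"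
proof -
  note I = ideal_polysD[OF J]
  \<comment> \<open>A crude common bound for the weights of all indeterminates in
    \<open>L\<close>.\<close>
  define M where "M = (\<Sum>x\<in>L. (fst x + snd x)\<^sup>2)"
  have bound: "line_wt v \<le> wt (\<lambda>_. 1) v * M" if "keys v \<subseteq> L" for v
  proof -
    have "(fst x + snd x)\<^sup>2 \<le> M" if "x \<in> L" for x
      unfolding M_def using that \<open>finite L\<close> by (intro member_le_sum) auto
    then have "(\<Sum>x\<in>keys v. lookup v x * (case x of (r, s) \<Rightarrow> (r + s)\<^sup>2)) \<le> (\<Sum>x\<in>keys v. lookup v x * M)"
      using that by (intro sum_mono mult_left_mono) (auto simp: case_prod_beta)
    then show ?thesis by (simp add: wt_def sum_distrib_right)
  qed
  show ?thesis using \<open>keys u \<subseteq> L\<close>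
  proof (induction "wt (\<lambda>_. 1) u * M - line_wt u" arbitrary: u rule: less_induct)
    case less
    show ?case
    proof (cases "F (keys u)")
      case True
      then show ?thesis using less.prems I(2) by (intro exI[of _ "single u 1"]) auto
    next
      case False
      let ?Std = "{w. keys w \<subseteq> L \<and> F (keys w) \<and> wt (\<lambda>_. 1) w = wt (\<lambda>_. 1) u}"
      obtain r where r: "single u 1 - r \<in> J"
        "\<And>v. v \<in> keys r \<Longrightarrow> keys v \<subseteq> L \<and> wt (\<lambda>_. 1) v = wt (\<lambda>_. 1) u \<and> line_wt u < line_wt v"
        using reduction_step[OF J red less.prems False] by blast
      have "\<exists>q. keys q \<subseteq> ?Std \<and> single v 1 - q \<in> J" if v: "v \<in> keys r" for v
      proof -
        have "wt (\<lambda>_. 1) v * M - line_wt v < wt (\<lambda>_. 1) u * M - line_wt u"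
          using r(2)[OF v] bound[of v] by auto
        from less.hyps[OF this] r(2)[OF v] show ?thesis by auto
      qed
      then obtain Q where Q: "\<And>v. v \<in> keys r \<Longrightarrow> keys (Q v) \<subseteq> ?Std \<and> single v 1 - Q v \<in> J"
        using bchoice[of "keys r" "\<lambda>v q. keys q \<subseteq> ?Std \<and> single v 1 - q \<in> J"] by blast
      define q where "q = (\<Sum>v\<in>keys r. single 0 (lookup r v) * Q v)"
      have keys_const: "keys (single 0 x * p) \<subseteq> keys p" for x and p :: "'k mpoly"
        using Poly_Mapping.keys_mult[of "single 0 x" p] by (auto split: if_splits)
      have "keys q \<subseteq> (\<Union>v\<in>keys r. keys (single 0 (lookup r v) * Q v))"
        unfolding q_def by (rule keys_sum)
      also have "\<dots> \<subseteq> ?Std" using Q keys_const by blast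
      finally have "keys q \<subseteq> ?Std" .
      moreover have "single u 1 - q \<in> J"
      proof -
        have "r = (\<Sum>v\<in>keys r. single 0 (lookup r v) * single v 1)"
          by (simp add: mult_single flip: poly_mapping_sum_single)
        then have "r - q = (\<Sum>v\<in>keys r. single 0 (lookup r v) * (single v 1 - Q v))"
          by (simp add: q_def right_diff_distrib sum_subtractf)
        also have "\<dots> \<in> J" using Q by (intro ideal_sum[OF J] I(4)) auto
        finally have "(single u 1 - r) + (r - q) \<in> J" by (rule I(3)[OF r(1)])
        then show ?thesis by simp
      qed
      ultimately show ?thesis by blast
    qed
  qed
qed

text \<open>Standard monomials lie in finitely many boxes, each over a support of at most
  \<open>D\<close> elements. So their number grows like a polynomial of degree \<open>D\<close>, and
  more than \<open>D\<close> indeterminates must be dependent modulo \<open>J\<close>.\<close>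

lemma independent_card_le:
  fixes J :: "'k::field mpoly set"
  assumes L: "finite L" and J: "ideal J (poly_ring L)" and red: "reducible_supports J L F"
    and F: "\<And>S. S \<subseteq> L \<Longrightarrow> F S \<Longrightarrow> card S \<le> D"
    and B: "B \<subseteq> L" "polys B \<inter> J = {0}"
  shows "card B \<le> D"
proof (rule ccontr)
  assume "\<not> card B \<le> D"
  then have less: "D < card B" by simp
  have finB: "finite B" using B(1) L finite_subset by auto
  note I = ideal_polysD[OF J]
  let ?Fs = "{S. S \<subseteq> L \<and> F S}"
  \<comment> \<open>A monomial in \<open>box B e\<close> has degree at most
    \<open>e * card B\<close>; reduction preserves the degree, and the degree bounds every single
    exponent.\<close>
  let ?C = "\<lambda>e. \<Union>S\<in>?Fs. box S (e * card B)"
  have finF: "finite ?Fs" by (rule finite_subset[of _ "Pow L"]) (use L in auto)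
  have finS: "finite S" if "S \<in> ?Fs" for S using that L finite_subset by auto
  obtain G where G: "G \<in> polys B" "G \<noteq> 0" "poly_val (single 0) indet G \<in> J"
  proof (rule algebraic_dependence[OF finB less I(2,3) I(4)])
    show "single 0 c \<in> (polys L :: 'k mpoly set)" for c by simp
    show "finite (?C e)" for e using finF finS finite_box by auto
    show "card (?C e) \<le> (card ?Fs * (card B + 1) ^ D) * (e + 1) ^ D" for e
    proof -
      have "card (?C e) \<le> (\<Sum>S\<in>?Fs. card (box S (e * card B)))"
        by (rule card_UN_le[OF finF])
      also have "\<dots> \<le> (\<Sum>S\<in>?Fs. ((card B + 1) * (e + 1)) ^ D)"
      proof (rule sum_mono)
        fix S assume S: "S \<in> ?Fs"
        have "card (box S (e * card B)) = (e * card B + 1) ^ card S"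
          using card_box[OF finS[OF S]] by simp
        also have "\<dots> \<le> (e * card B + 1) ^ D" using F S by (intro power_increasing) auto
        also have "\<dots> \<le> ((card B + 1) * (e + 1)) ^ D" by (intro power_mono) (simp_all add: algebra_simps)
        finally show "card (box S (e * card B)) \<le> ((card B + 1) * (e + 1)) ^ D" .
      qed
      also have "\<dots> = (card ?Fs * (card B + 1) ^ D) * (e + 1) ^ D"
        by (simp only: sum_constant power_mult_distrib mult.assoc of_nat_id)
      finally show ?thesis .
    qed
    show "\<exists>q. keys q \<subseteq> ?C e \<and> monom_val indet u - q \<in> J" if u: "u \<in> box B e" for u e
    proof -
      have "keys u \<subseteq> B" and ue: "lookup u v \<le> e" for v using u unfolding box_def by blast+
      have "wt (\<lambda>_. 1) u \<le> (\<Sum>v\<in>B. e)"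
        unfolding wt_superset[OF finB \<open>keys u \<subseteq> B\<close>] using ue by (intro sum_mono) simp
      then have deg: "wt (\<lambda>_. 1) u \<le> e * card B" by (simp add: mult.commute)
      have "keys u \<subseteq> L" using \<open>keys u \<subseteq> B\<close> B(1) by blast
      from standard_representation[OF L J red this] obtain q where
        q: "keys q \<subseteq> {w. keys w \<subseteq> L \<and> F (keys w) \<and> wt (\<lambda>_. 1) w = wt (\<lambda>_. 1) u}" "single u 1 - q \<in> J"
        by blast
      have "w \<in> ?C e" if "w \<in> keys q" for w
      proof -
        have w: "keys w \<subseteq> L" "F (keys w)" "wt (\<lambda>_. 1) w \<le> e * card B" using q(1) that deg by auto
        have "lookup w v \<le> e * card B" for v using lookup_le_wt[of w v] w(3) by linarith
        then have "w \<in> box (keys w) (e * card B)" by (simp add: box_def)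
        then show ?thesis using w by blast
      qed
      then show ?thesis using q(2) by (intro exI[of _ q] conjI subsetI) (simp_all only: monom_val_indet)
    qed
  qed
  then have "G \<in> polys B \<inter> J" by (simp add: poly_val_self)
  then show False using B(2) G(2) by auto
qed

subsection \<open>Supports of standard monomials in a ladder\<close>

definition ladder_support ::
  "(nat \<times> nat) set \<Rightarrow> nat \<Rightarrow> (nat \<Rightarrow> nat) \<Rightarrow> (nat \<Rightarrow> nat) \<Rightarrow> (nat \<Rightarrow> nat) \<Rightarrow> (nat \<times> nat) set \<Rightarrow> bool" where
  "ladder_support L k d c t S \<longleftrightarrow>
     (\<forall>j\<in>{1..k}. \<forall>e. card {x \<in> S \<inter> ladder_part L d c j. fst x + snd x = e} < t j)"

lemma ladderI:
  "i \<in> {1..h} \<Longrightarrow> j \<in> {1..k} \<Longrightarrow> b i \<le> r \<Longrightarrow> r \<le> d j \<Longrightarrow> c j \<le> s \<Longrightarrow> s \<le> a i \<Longrightarrow> (r, s) \<in> ladder h b a k d c"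
  unfolding ladder_def by blast

lemma ladderE:
  assumes "x \<in> ladder h b a k d c"
  obtains i j where "i \<in> {1..h}" "j \<in> {1..k}" "b i \<le> fst x" "fst x \<le> d j" "c j \<le> snd x" "snd x \<le> a i"
  using assms unfolding ladder_def by fastforce

lemma subladder_subset:
  assumes "\<And>j. j \<in> {1..k} \<Longrightarrow> t j \<ge> 1"
  shows "subladder h b a k d c t \<subseteq> ladder h b a k d c"
proof
  fix x assume "x \<in> subladder h b a k d c t"
  then obtain i j where x: "i \<in> {1..h}" "j \<in> {1..k}" "b i \<le> fst x" "fst x \<le> d j + 1 - t j"
    "c j + t j - 1 \<le> snd x" "snd x \<le> a i"
    unfolding subladder_def by (rule ladderE)
  then have "fst x \<le> d j" "c j \<le> snd x" using assms[of j] by auto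
  then have "(fst x, snd x) \<in> ladder h b a k d c" using x by (intro ladderI[of i _ j])
  then show "x \<in> ladder h b a k d c" by simp
qed

text \<open>On the line take the position \<open>x\<close> of \<open>L'\<close> with the largest
  row, and a corner \<open>j\<close> that puts it into \<open>L'\<close>. The \<open>t j - 1\<close>
  positions that follow it downwards lie in \<open>L_j\<close> but not in \<open>L'\<close>, whereas
  all positions of \<open>L'\<close> on the line lie in \<open>L_j\<close>. As \<open>S\<close>
  takes at most \<open>t j - 1\<close> positions of \<open>L_j\<close> on the line, it misses at
  least as many positions as \<open>L'\<close> has there.\<close>

lemma card_ladder_support_line:
  assumes L: "L = ladder h b a k d c" "finite L" and t: "\<And>j. j \<in> {1..k} \<Longrightarrow> t j \<ge> 1"
    and b: "\<And>i. i \<in> {1..h} \<Longrightarrow> b i \<ge> 1"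
    and S: "S \<subseteq> L" "ladder_support L k d c t S"
  shows "card {x \<in> S. fst x + snd x = e} \<le> card {x \<in> L - subladder h b a k d c t. fst x + snd x = e}"
proof -
  let ?L' = "subladder h b a k d c t"
  let ?on = "\<lambda>A. {x \<in> A. fst x + snd x = e}"
  have sub: "?L' \<subseteq> L" unfolding L(1) using t by (rule subladder_subset)
  have fin: "finite ?L'" using sub L(2) finite_subset by auto
  have "card (?on ?L') \<le> card (?on (L - S))"
  proof (cases "?on ?L' = {}")
    case False
    have "finite (fst ` ?on ?L')" using fin by auto
    then have "Max (fst ` ?on ?L') \<in> fst ` ?on ?L'" using False by (intro Max_in) auto
    then obtain x where x: "x \<in> ?on ?L'" "fst x = Max (fst ` ?on ?L')" by force
    have max: "fst z \<le> fst x" if "z \<in> ?on ?L'" for z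
      unfolding x(2) using that fin by (intro Max_ge) auto
    obtain i j where ij: "i \<in> {1..h}" "j \<in> {1..k}" "b i \<le> fst x" "fst x \<le> d j + 1 - t j"
      "c j + t j - 1 \<le> snd x" "snd x \<le> a i"
      using x(1) unfolding subladder_def by (auto elim: ladderE)
    \<comment> \<open>Since \<open>b i \<ge> 1\<close>, the truncated row bound of the corner is
      positive, so the subtraction in it is exact.\<close>
    have tj: "t j \<ge> 1" "t j \<le> d j" using t[OF ij(2)] b[OF ij(1)] ij(3,4) by auto
    define P where "P = (\<lambda>q. (fst x + q, snd x - q)) ` {1..t j - 1}"
    let ?Lj = "ladder_part L d c j"
    have P: "P \<subseteq> ?on ?Lj"
    proof
      fix y assume "y \<in> P"
      then obtain q where q: "y = (fst x + q, snd x - q)" "1 \<le> q" "q \<le> t j - 1" by (auto simp: P_def)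
      have "fst x + q \<le> d j" "c j \<le> snd x - q" "b i \<le> fst x + q" "snd x - q \<le> a i" "q \<le> snd x"
        using q ij tj by auto
      moreover from this have "y \<in> L" unfolding L(1) q(1) using ij(1,2) by (intro ladderI[of i _ j])
      ultimately show "y \<in> ?on ?Lj" using x(1) q(1) by (auto simp: ladder_part_def)
    qed
    have L': "?on ?L' \<subseteq> ?on ?Lj"
    proof
      fix z assume z: "z \<in> ?on ?L'"
      have "fst z \<le> d j" "c j \<le> snd z" using max[OF z] z x(1) ij tj by auto
      then show "z \<in> ?on ?Lj" using z sub by (auto simp: ladder_part_def)
    qed
    have finLj: "finite (?on ?Lj)" using L(2) by (auto simp: ladder_part_def intro: finite_subset[of _ L])
    have "card P = t j - 1" unfolding P_def by (subst card_image) (auto simp: inj_on_def)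
    have disj: "?on ?L' \<inter> P = {}" using max by (force simp: P_def)
    have "card (?on ?L') + (t j - 1) = card (?on ?L' \<union> P)"
      using disj \<open>card P = t j - 1\<close> finLj L' P by (subst card_Un_disjoint) (auto intro: finite_subset)
    also have "\<dots> \<le> card (?on ?Lj)"
      using L' P finLj by (intro card_mono) auto
    also have "\<dots> = card (?on (S \<inter> ?Lj) \<union> ?on (?Lj - S))" by (intro arg_cong[of _ _ card]) auto
    also have "\<dots> \<le> card (?on (S \<inter> ?Lj)) + card (?on (?Lj - S))" by (rule card_Un_le)
    also have "card (?on (?Lj - S)) \<le> card (?on (L - S))"
      using L(2) by (intro card_mono) (auto simp: ladder_part_def)
    finally have "card (?on ?L') + (t j - 1) \<le> card (?on (S \<inter> ?Lj)) + card (?on (L - S))" by simp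
    moreover have "card (?on (S \<inter> ?Lj)) < t j"
      using S(2) ij(2) unfolding ladder_support_def by blast
    ultimately show ?thesis by linarith
  next
    case True
    show ?thesis unfolding True by simp
  qed
  moreover have "card (?on L) = card (?on S) + card (?on (L - S))"
  proof -
    have "card (?on L) = card (?on S \<union> ?on (L - S))" using S(1) by (intro arg_cong[of _ _ card]) auto
    also have "\<dots> = card (?on S) + card (?on (L - S))"
      using L(2) S(1) by (intro card_Un_disjoint) (auto intro: finite_subset)
    finally show ?thesis .
  qed
  moreover have "card (?on L) = card (?on ?L') + card (?on (L - ?L'))"
  proof -
    have "card (?on L) = card (?on ?L' \<union> ?on (L - ?L'))" using sub by (intro arg_cong[of _ _ card]) auto
    also have "\<dots> = card (?on ?L') + card (?on (L - ?L'))"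
      using L(2) fin by (intro card_Un_disjoint) auto
    finally show ?thesis .
  qed
  ultimately show ?thesis by linarith
qed

lemma card_ladder_support:
  assumes L: "L = ladder h b a k d c" "finite L" and t: "\<And>j. j \<in> {1..k} \<Longrightarrow> t j \<ge> 1"
    and b: "\<And>i. i \<in> {1..h} \<Longrightarrow> b i \<ge> 1"
    and S: "S \<subseteq> L" "ladder_support L k d c t S"
  shows "card S \<le> card (L - subladder h b a k d c t)"
proof -
  let ?s = "\<lambda>x :: nat \<times> nat. fst x + snd x" and ?D = "L - subladder h b a k d c t"
  have fin: "finite S" "finite ?D" using S(1) L(2) finite_subset by auto
  have "(\<Sum>x\<in>S. 1 :: nat) = (\<Sum>e\<in>?s ` L. \<Sum>x\<in>{x \<in> S. ?s x = e}. 1)"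
    by (rule sum.group[symmetric]) (use fin L S in auto)
  also have "\<dots> \<le> (\<Sum>e\<in>?s ` L. \<Sum>x\<in>{x \<in> ?D. ?s x = e}. 1)"
    using card_ladder_support_line[where S = S, OF L _ _ S] t b by (intro sum_mono) simp
  also have "\<dots> = (\<Sum>x\<in>?D. 1)"
    by (rule sum.group) (use fin L in auto)
  finally show ?thesis by simp
qed

lemma reducible_supports_ladder:
  assumes L: "L = ladder h b a k d c" "L \<subseteq> {1..m} \<times> {1..n}" and t: "\<And>j. j \<in> {1..k} \<Longrightarrow> t j \<ge> 1"
    and J: "\<And>j. j \<in> {1..k} \<Longrightarrow> minors_in m n (t j) (ladder_part L d c j) \<subseteq> J"
  shows "reducible_supports J L (ladder_support L k d c t)"
  unfolding reducible_supports_def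
proof (intro allI impI)
  fix S assume S: "S \<subseteq> L" "\<not> ladder_support L k d c t S"
  then obtain j e where j: "j \<in> {1..k}" and card: "t j \<le> card {x \<in> S \<inter> ladder_part L d c j. fst x + snd x = e}"
    by (auto simp: ladder_support_def not_less)
  obtain T where T: "T \<subseteq> {x \<in> S \<inter> ladder_part L d c j. fst x + snd x = e}" "card T = t j" "finite T"
    using obtain_subset_with_card_n[OF card] by blast
  have sub: "fst ` T \<times> snd ` T \<subseteq> ladder_part L d c j"
  proof (rule subrelI)
    fix r s assume "(r, s) \<in> fst ` T \<times> snd ` T"
    then obtain x y where xy: "x \<in> T" "y \<in> T" "r = fst x" "s = snd y" by auto
    have x: "fst x + snd x = e" "x \<in> L" "fst x \<le> d j" using T(1) xy(1) by (auto simp: ladder_part_def)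
    have y: "fst y + snd y = e" "y \<in> L" "c j \<le> snd y" using T(1) xy(2) by (auto simp: ladder_part_def)
    \<comment> \<open>The entry combines the row of \<open>x\<close> with the column of
      \<open>y\<close>. If it is not above \<open>y\<close>, the upper corner of \<open>y\<close>
      serves. Otherwise \<open>x\<close> is above \<open>y\<close> on the same line, hence to the
      right of it, and the upper corner of \<open>x\<close> serves.\<close>
    have "\<exists>i\<in>{1..h}. b i \<le> r \<and> s \<le> a i"
    proof (cases "fst y \<le> r")
      case True
      obtain i where "i \<in> {1..h}" "b i \<le> fst y" "snd y \<le> a i" using y(2) unfolding L(1) by (rule ladderE)
      then show ?thesis using True xy(4) by (intro bexI[of _ i]) auto
    next
      case False
      obtain i where "i \<in> {1..h}" "b i \<le> fst x" "snd x \<le> a i" using x(2) unfolding L(1) by (rule ladderE)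
      then show ?thesis using False xy(3,4) x(1) y(1) by (intro bexI[of _ i]) auto
    qed
    then have "(r, s) \<in> L"
      unfolding L(1) using x(3) y(3) xy(3,4) j by (auto intro: ladderI)
    then show "(r, s) \<in> ladder_part L d c j"
      using x(3) y(3) xy(3,4) by (simp add: ladder_part_def)
  qed
  have "T \<subseteq> S" using T by auto
  have "card T = t j \<and> t j \<ge> 1 \<and>
     (\<forall>x\<in>T. fst x + snd x = e) \<and> fst ` T \<times> snd ` T \<subseteq> L \<and>
     (\<forall>f g. strict_mono_on {..<t j} f \<longrightarrow> (\<forall>i<t j. f i \<in> fst ` T) \<longrightarrow>
        strict_mono_on {..<t j} g \<longrightarrow> (\<forall>i<t j. g i \<in> snd ` T) \<longrightarrow> minor (t j) f g \<in> J)"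
  proof (intro conjI allI impI ballI)
    show "card T = t j" by (rule T(2))
    show "1 \<le> t j" using t j by auto
    show "fst x + snd x = e" if "x \<in> T" for x using T(1) that by auto
    show "fst ` T \<times> snd ` T \<subseteq> L" using sub by (auto simp: ladder_part_def)
    fix f g assume f: "strict_mono_on {..<t j} f" "\<forall>i<t j. f i \<in> fst ` T"
      and g: "strict_mono_on {..<t j} g" "\<forall>i<t j. g i \<in> snd ` T"
    have T': "fst ` T \<subseteq> {1..m}" "snd ` T \<subseteq> {1..n}" using \<open>T \<subseteq> S\<close> S(1) L(2) by fastforce+
    have "minor (t j) f g \<in> minors_in m n (t j) (ladder_part L d c j)"
    proof (rule minor_in_minors_in[OF f(1) _ g(1)])
      fix i assume "i < t j"
      then have fg: "f i \<in> fst ` T" "g i \<in> snd ` T" using f(2) g(2) by blast+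
      then show "f i \<in> {1..m}" "g i \<in> {1..n}" using T' by (blast dest: subsetD)+
    next
      fix i i' assume "i < t j" "i' < t j"
      then have "(f i, g i') \<in> fst ` T \<times> snd ` T" using f(2) g(2) by (intro SigmaI) simp_all
      then show "(f i, g i') \<in> ladder_part L d c j" using sub by (rule subsetD[rotated])
    qed
    then show "minor (t j) f g \<in> J" using J[OF j] by blast
  qed
  with \<open>T \<subseteq> S\<close> show "\<exists>T\<subseteq>S. \<exists>t e. card T = t \<and> t \<ge> 1 \<and>
     (\<forall>x\<in>T. fst x + snd x = e) \<and> fst ` T \<times> snd ` T \<subseteq> L \<and>
     (\<forall>f g. strict_mono_on {..<t} f \<longrightarrow> (\<forall>i<t. f i \<in> fst ` T) \<longrightarrow>
        strict_mono_on {..<t} g \<longrightarrow> (\<forall>i<t. g i \<in> snd ` T) \<longrightarrow> minor t f g \<in> J)"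
    by (intro exI[of _ T] conjI[OF _ exI[of _ "t j", OF exI[of _ e]]])
qed

subsection \<open>Nonvanishing points\<close>

text \<open>Induction on the indeterminates: at a point where no leading coefficient in
  \<open>y\<close> vanishes, only finitely many values of \<open>y\<close> are excluded. A finite
  family is treated at once because several genericity conditions are imposed together.\<close>

lemma nonvanishing_point:
  fixes F :: "'k::field mpoly set"
  assumes inf: "infinite (UNIV :: 'k set)" and "finite V" "finite F" "F \<subseteq> polys V" "0 \<notin> F"
  shows "\<exists>\<sigma>. \<forall>p\<in>F. poly_val (\<lambda>c. c) \<sigma> p \<noteq> 0"
  using assms(2-5)
proof (induction V arbitrary: F rule: finite_induct)
  case empty
  have "poly_val (\<lambda>c. c) undefined p \<noteq> 0" if "p \<in> F" for p
  proof -
    have p: "p = single 0 (lookup p 0)" using empty.prems(2) that by (intro polys_empty) auto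
    then have "lookup p 0 \<noteq> 0" using empty.prems(3) that by auto
    then show ?thesis by (subst p) (simp add: poly_val_const[OF id_hom])
  qed
  then show ?case by blast
next
  case (insert y V)
  let ?F = "(\<lambda>p. lead_coeff (to_univ y p)) ` F"
  have "?F \<subseteq> polys V" using insert.prems(2) by (auto intro!: coeff_to_univ_in_polys)
  moreover have "0 \<notin> ?F" using insert.prems(3) by (auto simp: to_univ_eq_0_iff)
  ultimately obtain \<sigma> where \<sigma>: "\<And>p. p \<in> F \<Longrightarrow> poly_val (\<lambda>c. c) \<sigma> (lead_coeff (to_univ y p)) \<noteq> 0"
    using insert.IH[of ?F] insert.prems(1) by blast
  let ?P = "\<lambda>p. map_poly (poly_val (\<lambda>c. c) \<sigma>) (to_univ y p)"
  have "?P p \<noteq> 0" if "p \<in> F" for p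
  proof -
    have "coeff (?P p) (degree (to_univ y p)) \<noteq> 0"
      using \<sigma>[OF that] by (simp add: coeff_map_poly poly_val_zero[OF id_hom])
    then show ?thesis by auto
  qed
  then have "finite (\<Union>p\<in>F. {z. poly (?P p) z = 0})"
    using insert.prems(1) by (auto intro: poly_roots_finite)
  then obtain z where z: "\<And>p. p \<in> F \<Longrightarrow> poly (?P p) z \<noteq> 0"
    using ex_new_if_finite[OF inf] by blast
  define \<tau> where "\<tau> = \<sigma>(y := z)"
  have "poly_val (\<lambda>c. c) \<tau> p \<noteq> 0" if p: "p \<in> F" for p
  proof -
    have "coeff (to_univ y p) e \<in> polys V" for e
      using insert.prems(2) p by (intro coeff_to_univ_in_polys) auto
    then have "poly_val (\<lambda>c. c) \<tau> (coeff (to_univ y p) e) = poly_val (\<lambda>c. c) \<sigma> (coeff (to_univ y p) e)" for e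
      by (rule poly_val_cong) (use insert.hyps in \<open>auto simp: \<tau>_def\<close>)
    then have "map_poly (poly_val (\<lambda>c. c) \<tau>) (to_univ y p) = ?P p"
      by (intro poly_eqI) (simp add: coeff_map_poly poly_val_zero[OF id_hom])
    moreover have "\<tau> y = z" by (simp add: \<tau>_def)
    ultimately have "poly_val (\<lambda>c. c) \<tau> p = poly (?P p) z"
      using poly_val_to_univ[OF id_hom, of \<tau> p y] by simp
    then show ?thesis using z[OF p] by simp
  qed
  then show ?case by blast
qed

text \<open>If the field were finite, 1 plus the product of all \<open>X - x\<close> would take only
  the value 1 and so have no root.\<close>

lemma infinite_alg_closed_field: "infinite (UNIV :: 'k::alg_closed_field set)"
proof
  assume fin: "finite (UNIV :: 'k set)"
  define p :: "'k poly" where "p = (\<Prod>x\<in>UNIV. [:- x, 1:])"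
  have "degree p = (\<Sum>x\<in>(UNIV :: 'k set). degree [:- x, 1:])"
    unfolding p_def by (rule degree_prod_eq_sum_degree) simp
  also have "\<dots> = card (UNIV :: 'k set)" by simp
  also have "\<dots> > 0" using fin by (simp add: card_gt_0_iff)
  finally have "degree (1 + p) > 0" by (subst degree_add_eq_right) simp_all
  then obtain x where "poly (1 + p) x = 0" using alg_closed_imp_poly_has_root by blast
  moreover have "poly p x = 0" using fin by (simp add: p_def poly_prod prod_zero_iff)
  ultimately show False by simp
qed

subsection \<open>Completing a matrix with prescribed rank bounds\<close>

lemma inverse_matrix_entries:
  fixes S :: "nat \<Rightarrow> nat \<Rightarrow> 'k::field"
  assumes "det (mat s s (\<lambda>(q, p). S q p)) \<noteq> 0"
  shows "\<exists>g. (\<forall>q<s. \<forall>q'<s. (\<Sum>p<s. S q p * g p q') = (if q = q' then 1 else 0)) \<and>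
             (\<forall>p<s. \<forall>p'<s. (\<Sum>q<s. g p q * S q p') = (if p = p' then 1 else 0))"
proof -
  let ?A = "mat s s (\<lambda>(q, p). S q p)"
  have A: "?A \<in> carrier_mat s s" by simp
  note adj = adj_mat[OF A]
  let ?g = "\<lambda>p q. adj_mat ?A $$ (p, q) / det ?A"
  have right: "(\<Sum>p<s. S q p * ?g p q') = (if q = q' then 1 else 0)" if "q < s" "q' < s" for q q'
  proof -
    have "(?A * adj_mat ?A) $$ (q, q') = (\<Sum>p<s. S q p * adj_mat ?A $$ (p, q'))"
      using that adj(1) by (simp add: scalar_prod_def atLeast0LessThan)
    then have "(\<Sum>p<s. S q p * adj_mat ?A $$ (p, q')) = (if q = q' then det ?A else 0)"
      unfolding adj(2) using that by (cases "q = q'") simp_all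
    then show ?thesis using assms by (simp flip: sum_divide_distrib)
  qed
  have left: "(\<Sum>q<s. ?g p q * S q p') = (if p = p' then 1 else 0)" if "p < s" "p' < s" for p p'
  proof -
    have "(adj_mat ?A * ?A) $$ (p, p') = (\<Sum>q<s. adj_mat ?A $$ (p, q) * S q p')"
      using that adj(1) by (simp add: scalar_prod_def atLeast0LessThan)
    then have "(\<Sum>q<s. adj_mat ?A $$ (p, q) * S q p') = (if p = p' then det ?A else 0)"
      unfolding adj(3) using that by (cases "p = p'") simp_all
    then show ?thesis using assms by (simp flip: sum_divide_distrib)
  qed
  show ?thesis by (intro exI[of _ ?g] conjI allI impI right left)
qed

text \<open>Well-founded recursion in the form of an existence statement, so that a matrix can be
  defined recursively inside the proof of \<open>rank_completion\<close>.\<close>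

lemma wf_recursion_exists:
  fixes \<mu> :: "'x \<Rightarrow> nat" and \<Phi> :: "('x \<Rightarrow> 'y) \<Rightarrow> 'x \<Rightarrow> 'y"
  assumes "\<And>X Y x. (\<And>y. \<mu> y < \<mu> x \<Longrightarrow> X y = Y y) \<Longrightarrow> \<Phi> X x = \<Phi> Y x"
  shows "\<exists>X. \<forall>x. X x = \<Phi> X x"
proof -
  have "adm_wf (measure \<mu>) \<Phi>" unfolding adm_wf_def by (intro allI impI assms) simp
  from wfrec_fixpoint[OF wf_measure this] show ?thesis
    by (intro exI[of _ "wfrec (measure \<mu>) \<Phi>"] allI) (rule fun_cong)
qed

text \<open>The block of the rows \<open>r \<le> d j\<close> and the columns \<open>s \<ge> c j\<close> is to have rank at most
  \<open>t j - 1\<close>. If the square in its lower left corner is invertible, then all its entries outside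
  the last \<open>t j - 1\<close> rows and the first \<open>t j - 1\<close> columns are determined by the other ones. Where
  blocks overlap, the entry determined by the first one also fits all the others.\<close>

lemma rank_completion:
  fixes \<sigma> :: "nat \<times> nat \<Rightarrow> 'k::field" and d c t :: "nat \<Rightarrow> nat"
  defines "Hole \<equiv> \<lambda>j. {(r, s). r \<le> d j + 1 - t j \<and> c j + t j - 1 \<le> s}"
  assumes t: "\<And>j. j \<in> I \<Longrightarrow> 1 \<le> t j \<and> t j \<le> d j" and dm: "\<And>j. j \<in> I \<Longrightarrow> d j \<le> m"
    and mono: "\<And>i j. i \<in> I \<Longrightarrow> j \<in> I \<Longrightarrow> i < j \<Longrightarrow> d i \<le> d j \<and> c i \<le> c j"
    and sep: "\<And>i j. i \<in> I \<Longrightarrow> j \<in> I \<Longrightarrow> i < j \<Longrightarrow> d i + t j < d j + t i \<and> c i + t i < c j + t j"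
    and nonsing: "\<And>j. j \<in> I \<Longrightarrow>
      det (mat (t j - 1) (t j - 1) (\<lambda>(q, p). \<sigma> (d j + 2 - t j + q, c j + p))) \<noteq> 0"
  shows "\<exists>X. (\<forall>x. x \<notin> \<Union> (Hole ` I) \<longrightarrow> X x = \<sigma> x) \<and>
    (\<forall>j\<in>I. \<exists>Y Z. \<forall>r s. r \<le> d j \<longrightarrow> c j \<le> s \<longrightarrow> X (r, s) = (\<Sum>p<t j - 1. Y r p * Z p s))"
proof -
  \<comment> \<open>These index the invertible square of block \<open>j\<close>: the last
    \<open>t j - 1\<close> rows, which start at \<open>d j + 2 - t j\<close>, and the first
    \<open>t j - 1\<close> columns.\<close>
  define R C where "R j q = d j + 2 - t j + q" and "C j p = c j + p" for j q p
  define \<rho> where "\<rho> j = t j - 1" for j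
  let ?S = "\<lambda>j q p. \<sigma> (R j q, C j p)"
  have "\<forall>j\<in>I. \<exists>g. (\<forall>q<\<rho> j. \<forall>q'<\<rho> j. (\<Sum>p<\<rho> j. ?S j q p * g p q') = (if q = q' then 1 else 0)) \<and>
             (\<forall>p<\<rho> j. \<forall>p'<\<rho> j. (\<Sum>q<\<rho> j. g p q * ?S j q p') = (if p = p' then 1 else 0))"
    using nonsing by (intro ballI inverse_matrix_entries) (simp add: R_def C_def \<rho>_def)
  then obtain g where g1: "\<And>j q q'. j \<in> I \<Longrightarrow> q < \<rho> j \<Longrightarrow> q' < \<rho> j \<Longrightarrow>
        (\<Sum>p<\<rho> j. ?S j q p * g j p q') = (if q = q' then 1 else 0)"
    and g2: "\<And>j p p'. j \<in> I \<Longrightarrow> p < \<rho> j \<Longrightarrow> p' < \<rho> j \<Longrightarrow>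
        (\<Sum>q<\<rho> j. g j p q * ?S j q p') = (if p = p' then 1 else 0)"
    by (elim bchoice[THEN exE]) blast
  \<comment> \<open>With \<open>g j\<close> the inverse of the square, this is the value at
    \<open>(r, s)\<close> for which the Schur complement of the square vanishes.\<close>
  define form where "form X j r s = (\<Sum>p<\<rho> j. \<Sum>q<\<rho> j. X (r, C j p) * g j p q * X (R j q, s))"
    for X :: "nat \<times> nat \<Rightarrow> 'k" and j r s
  \<comment> \<open>The least index is taken for the sake of overlaps: for \<open>i < j\<close> the
    rows \<open>R i q\<close> belong to block \<open>j\<close> and the columns \<open>C j p\<close>
    to block \<open>i\<close>.\<close>
  define first where "first x = (LEAST j. j \<in> I \<and> x \<in> Hole j)" for x
  have first: "first x \<in> I \<and> x \<in> Hole (first x) \<and> first x \<le> j" if "j \<in> I" "x \<in> Hole j" for x j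
    unfolding first_def using LeastI[of "\<lambda>j. j \<in> I \<and> x \<in> Hole j" j] Least_le[of "\<lambda>j. j \<in> I \<and> x \<in> Hole j" j] that
    by blast
  \<comment> \<open>The recursion proceeds from the lower left, since \<open>form\<close> refers to
    entries further left in the same row and further down in the same column. Rows up to
    \<open>m\<close> suffice because \<open>d j \<le> m\<close>.\<close>
  define \<mu> where "\<mu> = (\<lambda>(r :: nat, s :: nat). (m - r) + s)"
  have less_C: "\<mu> (r, C j p) < \<mu> (r, s)" if "p < \<rho> j" "c j + t j - 1 \<le> s" for j p r s
    using that by (auto simp: \<mu>_def C_def \<rho>_def)
  have R_bounds: "r < R j q" "R j q \<le> d j" if "j \<in> I" "q < \<rho> j" "r \<le> d j + 1 - t j" for j q r
    using that t[OF that(1)] by (auto simp: R_def \<rho>_def)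
  have less_R: "\<mu> (R j q, s) < \<mu> (r, s)" if "j \<in> I" "q < \<rho> j" "r \<le> d j + 1 - t j" for j q r s
    using R_bounds[OF that] dm[OF that(1)] by (simp add: \<mu>_def)
  have "\<exists>X. \<forall>x. X x = (if x \<in> \<Union> (Hole ` I) then form X (first x) (fst x) (snd x) else \<sigma> x)"
  proof (rule wf_recursion_exists[of \<mu>])
    fix X Y :: "nat \<times> nat \<Rightarrow> 'k" and x
    assume eq: "\<And>y. \<mu> y < \<mu> x \<Longrightarrow> X y = Y y"
    show "(if x \<in> \<Union> (Hole ` I) then form X (first x) (fst x) (snd x) else \<sigma> x) =
          (if x \<in> \<Union> (Hole ` I) then form Y (first x) (fst x) (snd x) else \<sigma> x)"
    proof (cases "x \<in> \<Union> (Hole ` I)")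
      case True
      then have j: "first x \<in> I" "x \<in> Hole (first x)" using first by blast+
      have "form X (first x) (fst x) (snd x) = form Y (first x) (fst x) (snd x)"
        unfolding form_def
      proof (intro sum.cong refl)
        fix p q assume pq: "p \<in> {..<\<rho> (first x)}" "q \<in> {..<\<rho> (first x)}"
        have "X (fst x, C (first x) p) = Y (fst x, C (first x) p)"
          using j pq less_C[of p "first x" "snd x" "fst x"] by (intro eq) (auto simp: Hole_def)
        moreover have "X (R (first x) q, snd x) = Y (R (first x) q, snd x)"
          using j pq less_R[of "first x" q "fst x" "snd x"] by (intro eq) (auto simp: Hole_def)
        ultimately show "X (fst x, C (first x) p) * g (first x) p q * X (R (first x) q, snd x) =
          Y (fst x, C (first x) p) * g (first x) p q * Y (R (first x) q, snd x)" by simp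
      qed
      then show ?thesis by simp
    qed simp
  qed
  then obtain X where X: "\<And>x. X x = (if x \<in> \<Union> (Hole ` I) then form X (first x) (fst x) (snd x) else \<sigma> x)"
    by blast
  \<comment> \<open>The corner inequalities keep the square of block \<open>j\<close> out of every
    hole: it lies below the holes of earlier blocks and to the left of those of later ones.\<close>
  have square: "X (R j q, C j p) = ?S j q p" if j: "j \<in> I" and q: "q < \<rho> j" and p: "p < \<rho> j" for j p q
  proof -
    have "(R j q, C j p) \<notin> Hole i" if i: "i \<in> I" for i
    proof -
      consider "i = j" | "i < j" | "j < i" by linarith
      then show ?thesis
      proof cases
        case 1
        then show ?thesis using q t[OF j] by (auto simp: Hole_def R_def \<rho>_def)
      next
        case 2
        then show ?thesis using sep[OF i j 2] q t[OF i] t[OF j] by (auto simp: Hole_def R_def \<rho>_def)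
      next
        case 3
        then show ?thesis using sep[OF j i 3] p t[OF i] t[OF j] by (auto simp: Hole_def C_def \<rho>_def)
      qed
    qed
    then have "(R j q, C j p) \<notin> \<Union> (Hole ` I)" by blast
    then show ?thesis by (subst X) simp
  qed
  \<comment> \<open>In the last rows and the first columns of the block, the inverse cancels against
    the square. In the hole the formula holds by construction if \<open>j\<close> is the first block
    there; the overlap is the remaining case.\<close>
  have claim: "X (r, s) = form X j r s" if "j \<in> I" "r \<le> d j" "c j \<le> s" for j r s
    using that
  proof (induction "\<mu> (r, s)" arbitrary: j r s rule: less_induct)
    case less
    note j = less.prems(1)
    consider "d j + 1 - t j < r" | "s < c j + t j - 1" | "(r, s) \<in> Hole j"
      unfolding Hole_def by (cases "d j + 1 - t j < r"; cases "s < c j + t j - 1") (auto simp: not_less)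
    then show ?case
    proof cases
      case 1
      define q0 where "q0 = r - (d j + 2 - t j)"
      have q0: "q0 < \<rho> j" "r = R j q0" using 1 less.prems(2) t[OF j] by (auto simp: q0_def R_def \<rho>_def)
      have "form X j r s = (\<Sum>q<\<rho> j. \<Sum>p<\<rho> j. ?S j q0 p * g j p q * X (R j q, s))"
        unfolding form_def q0(2) using q0(1) by (subst sum.swap) (simp add: square[OF j])
      also have "\<dots> = (\<Sum>q<\<rho> j. (\<Sum>p<\<rho> j. ?S j q0 p * g j p q) * X (R j q, s))"
        by (simp add: sum_distrib_right)
      also have "\<dots> = (\<Sum>q<\<rho> j. if q0 = q then X (R j q, s) else 0)"
        using q0(1) by (intro sum.cong) (auto simp: g1[OF j])
      also have "\<dots> = X (r, s)" using q0 by simp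
      finally show ?thesis by simp
    next
      case 2
      define p0 where "p0 = s - c j"
      have p0: "p0 < \<rho> j" "s = C j p0" using 2 less.prems(3) by (auto simp: p0_def C_def \<rho>_def)
      have "form X j r s = (\<Sum>p<\<rho> j. X (r, C j p) * (\<Sum>q<\<rho> j. g j p q * ?S j q p0))"
        unfolding form_def p0(2) using p0(1) by (simp add: square[OF j] sum_distrib_left mult.assoc)
      also have "\<dots> = (\<Sum>p<\<rho> j. if p = p0 then X (r, C j p) else 0)"
        using p0(1) by (intro sum.cong) (auto simp: g2[OF j])
      also have "\<dots> = X (r, s)" using p0 by simp
      finally show ?thesis by simp
    next
      case 3
      define i where "i = first (r, s)"
      have i: "i \<in> I" "(r, s) \<in> Hole i" "i \<le> j" using first[OF j 3] by (auto simp: i_def)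
      have Xi: "X (r, s) = form X i r s" using 3 j by (subst X) (auto simp: i_def)
      show ?thesis
      proof (cases "i = j")
        case True
        then show ?thesis using Xi by simp
      next
        case False
        then have ij: "i < j" using i(3) by simp
        have ri: "r \<le> d i + 1 - t i" using i(2) by (simp add: Hole_def)
        have sj: "c j + t j - 1 \<le> s" using 3 by (simp add: Hole_def)
        \<comment> \<open>Block \<open>i\<close> expresses row \<open>r\<close> as the combination
          \<open>\<alpha>\<close> of the rows \<open>R i q\<close>, both in the columns
          \<open>C j p\<close> (by induction) and in column \<open>s\<close> (by construction). The
          rows \<open>R i q\<close> satisfy the formula of block \<open>j\<close> at
          \<open>s\<close> by induction, and the combination \<open>\<alpha>\<close> transfers it to
          row \<open>r\<close>.\<close>
        define \<alpha> where "\<alpha> q = (\<Sum>p<\<rho> i. X (r, C i p) * g i p q)" for q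
        have form_i: "form X i r s' = (\<Sum>q<\<rho> i. \<alpha> q * X (R i q, s'))" for s'
          unfolding form_def \<alpha>_def by (subst sum.swap) (simp add: sum_distrib_right)
        have row: "X (r, C j p) = (\<Sum>q<\<rho> i. \<alpha> q * X (R i q, C j p))" if "p < \<rho> j" for p
        proof -
          have "X (r, C j p) = form X i r (C j p)"
          proof (rule less.hyps)
            show "\<mu> (r, C j p) < \<mu> (r, s)" by (rule less_C[OF that sj])
            show "r \<le> d i" using ri t[OF i(1)] by linarith
            show "c i \<le> C j p" using mono[OF i(1) j ij] by (simp add: C_def)
          qed (rule i(1))
          then show ?thesis by (simp add: form_i)
        qed
        have below: "X (R i q, s) = form X j (R i q) s" if "q < \<rho> i" for q
        proof (rule less.hyps[OF less_R[OF i(1) that ri] j])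
          show "R i q \<le> d j" using R_bounds(2)[OF i(1) that ri] mono[OF i(1) j ij] by simp
          show "c j \<le> s" by (rule less.prems(3))
        qed
        have "form X j r s = (\<Sum>p<\<rho> j. \<Sum>q<\<rho> j. \<Sum>q'<\<rho> i. \<alpha> q' * (X (R i q', C j p) * g j p q * X (R j q, s)))"
          unfolding form_def by (intro sum.cong refl) (simp add: row sum_distrib_right mult.assoc)
        also have "\<dots> = (\<Sum>p<\<rho> j. \<Sum>q'<\<rho> i. \<Sum>q<\<rho> j. \<alpha> q' * (X (R i q', C j p) * g j p q * X (R j q, s)))"
          by (intro sum.cong refl sum.swap)
        also have "\<dots> = (\<Sum>q'<\<rho> i. \<Sum>p<\<rho> j. \<Sum>q<\<rho> j. \<alpha> q' * (X (R i q', C j p) * g j p q * X (R j q, s)))"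
          by (rule sum.swap)
        also have "\<dots> = (\<Sum>q'<\<rho> i. \<alpha> q' * form X j (R i q') s)"
          by (simp add: form_def sum_distrib_left)
        also have "\<dots> = (\<Sum>q'<\<rho> i. \<alpha> q' * X (R i q', s))"
          by (intro sum.cong refl) (simp add: below)
        also have "\<dots> = X (r, s)" using Xi form_i[of s] by simp
        finally show ?thesis by simp
      qed
    qed
  qed
  have "\<exists>Y Z. \<forall>r s. r \<le> d j \<longrightarrow> c j \<le> s \<longrightarrow> X (r, s) = (\<Sum>p<t j - 1. Y r p * Z p s)" if "j \<in> I" for j
    by (rule exI[of _ "\<lambda>r p. X (r, C j p)"], rule exI[of _ "\<lambda>p s. \<Sum>q<\<rho> j. g j p q * X (R j q, s)"])
      (simp add: claim[OF that] form_def sum_distrib_left mult.assoc \<rho>_def)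
  moreover have "X x = \<sigma> x" if "x \<notin> \<Union> (Hole ` I)" for x using that by (subst X) simp
  ultimately show ?thesis by blast
qed

text \<open>The factors are padded to square matrices so that the determinant is multiplicative; the
  second one then has a zero last row.\<close>

lemma det_low_rank:
  fixes Y Z :: "nat \<Rightarrow> nat \<Rightarrow> 'k::field"
  assumes "t \<ge> 1"
  shows "det (mat t t (\<lambda>(i, j). \<Sum>p<t - 1. Y i p * Z p j)) = 0"
proof -
  let ?A = "mat t t (\<lambda>(i, p). Y i p)" and ?B = "mat t t (\<lambda>(p, j). if p < t - 1 then Z p j else 0)"
  obtain t' where t': "t = Suc t'" using assms by (cases t) auto
  have "mat t t (\<lambda>(i, j). \<Sum>p<t - 1. Y i p * Z p j) = ?A * ?B"
    by (intro eq_matI) (auto simp: scalar_prod_def atLeast0LessThan t')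
  moreover have "det ?B = 0"
    by (subst laplace_expansion_row[of _ t t']) (simp_all add: t')
  ultimately show ?thesis using det_mult[of ?A t ?B] by simp
qed

lemma poly_val_minor:
  assumes "comm_ring_hom h"
  shows "poly_val h \<sigma> (minor s f g) = det (mat s s (\<lambda>(i, j). \<sigma> (f i, g j)))"
proof -
  interpret v: comm_ring_hom "poly_val h \<sigma>" by (rule poly_val_hom[OF assms])
  show ?thesis
    unfolding minor_def v.hom_det[symmetric]
    by (intro arg_cong[of _ _ det] eq_matI) (simp_all add: poly_val_indet[OF assms])
qed

subsection \<open>Laplace expansion of minors\<close>

lemma minor_expand_row:
  assumes J: "ideal J (poly_ring V)" and V: "\<And>j. j < Suc s \<Longrightarrow> (f s, g j) \<in> V"
    and sub: "\<And>j. j < Suc s \<Longrightarrow> minor s f (\<lambda>l. if l < j then g l else g (Suc l)) \<in> J"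
  shows "minor (Suc s) f g \<in> (J :: 'k::comm_ring_1 mpoly set)"
proof -
  let ?A = "mat (Suc s) (Suc s) (\<lambda>(i, j). indet (f i, g j)) :: 'k mpoly mat"
  have cof: "cofactor ?A s j = (- 1) ^ (s + j) * minor s f (\<lambda>l. if l < j then g l else g (Suc l))"
    if "j < Suc s" for j
    unfolding cofactor_def minor_def mat_delete_def
    by (intro arg_cong2[of _ _ _ _ "(*)"] refl arg_cong[of _ _ det] eq_matI) (use that in auto)
  have "det ?A = (\<Sum>j<Suc s. ?A $$ (s, j) * cofactor ?A s j)"
    by (rule laplace_expansion_row) simp_all
  also have "\<dots> = (\<Sum>j<Suc s. indet (f s, g j) *
      ((- 1) ^ (s + j) * minor s f (\<lambda>l. if l < j then g l else g (Suc l))))"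
    using cof by (intro sum.cong) simp_all
  also have "\<dots> \<in> J"
    using V sub
    by (intro ideal_sum[OF J] ideal_polysD(4)[OF J] polys_indet polys_power polys_uminus) auto
  finally show ?thesis by (simp add: minor_def)
qed

lemma minor_expand_column:
  assumes J: "ideal J (poly_ring V)" and V: "\<And>i. i < Suc s \<Longrightarrow> (f i, g 0) \<in> V"
    and sub: "\<And>i. i < Suc s \<Longrightarrow> minor s (\<lambda>l. if l < i then f l else f (Suc l)) (\<lambda>l. g (Suc l)) \<in> J"
  shows "minor (Suc s) f g \<in> (J :: 'k::comm_ring_1 mpoly set)"
proof -
  let ?A = "mat (Suc s) (Suc s) (\<lambda>(i, j). indet (f i, g j)) :: 'k mpoly mat"
  have cof: "cofactor ?A i 0 = (- 1) ^ i * minor s (\<lambda>l. if l < i then f l else f (Suc l)) (\<lambda>l. g (Suc l))"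
    if "i < Suc s" for i
    unfolding cofactor_def minor_def mat_delete_def
    by (intro arg_cong2[of _ _ _ _ "(*)"] refl arg_cong[of _ _ det] eq_matI) (use that in auto)
  have "det ?A = (\<Sum>i<Suc s. ?A $$ (i, 0) * cofactor ?A i 0)"
    by (rule laplace_expansion_column) simp_all
  also have "\<dots> = (\<Sum>i<Suc s. indet (f i, g 0) *
      ((- 1) ^ i * minor s (\<lambda>l. if l < i then f l else f (Suc l)) (\<lambda>l. g (Suc l))))"
    using cof by (intro sum.cong) simp_all
  also have "\<dots> \<in> J"
    using V sub
    by (intro ideal_sum[OF J] ideal_polysD(4)[OF J] polys_indet polys_power polys_uminus) auto
  finally show ?thesis by (simp add: minor_def)
qed

lemma strict_mono_on_skip:
  "strict_mono_on {..<Suc s} g \<Longrightarrow> strict_mono_on {..<s} (\<lambda>l. if l < j then g l else g (Suc l))"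
  by (auto simp: strict_mono_on_def)

text \<open>Repeated expansion along the last row keeps the first \<open>t\<close> rows but leaves
  an arbitrary choice of columns, hence the quantification over \<open>g\<close> in the base
  case.\<close>

lemma minor_mem_drop_rows:
  assumes J: "ideal J (poly_ring V :: 'k::comm_ring_1 mpoly ring)" and "t \<le> s"
    and base: "\<And>g. strict_mono_on {..<t} g \<Longrightarrow> g ` {..<t} \<subseteq> X \<Longrightarrow> minor t f g \<in> J"
    and V: "\<And>i x. i < s \<Longrightarrow> x \<in> X \<Longrightarrow> (f i, x) \<in> V"
    and g: "strict_mono_on {..<s} g" "g ` {..<s} \<subseteq> X"
  shows "minor s f g \<in> J"
  using \<open>t \<le> s\<close> V g
proof (induction s arbitrary: g rule: dec_induct)
  case base
  then show ?case using assms(3) by blast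
next
  case (step s)
  show ?case
  proof (rule minor_expand_row[OF J])
    fix j assume j: "j < Suc s"
    then show "(f s, g j) \<in> V" using step.prems by (intro step.prems(1)) auto
    show "minor s f (\<lambda>l. if l < j then g l else g (Suc l)) \<in> J"
    proof (rule step.IH)
      show "(\<lambda>l. if l < j then g l else g (Suc l)) ` {..<s} \<subseteq> X"
        using step.prems(3) by auto
    qed (use step.prems strict_mono_on_skip in auto)
  qed
qed

text \<open>Here the first column is expanded each time, so the last \<open>t\<close> columns
  survive and the column index shifts by \<open>e\<close>.\<close>

lemma minor_mem_drop_columns:
  assumes J: "ideal J (poly_ring V :: 'k::comm_ring_1 mpoly ring)"
    and base: "\<And>f. strict_mono_on {..<t} f \<Longrightarrow> f ` {..<t} \<subseteq> X \<Longrightarrow> minor t f (\<lambda>l. g (e + l)) \<in> J"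
    and V: "\<And>l x. l < t + e \<Longrightarrow> x \<in> X \<Longrightarrow> (x, g l) \<in> V"
    and f: "strict_mono_on {..<t + e} f" "f ` {..<t + e} \<subseteq> X"
  shows "minor (t + e) f g \<in> J"
  using base V f
proof (induction e arbitrary: f g)
  case 0
  then show ?case by simp
next
  case (Suc e)
  have "minor (Suc (t + e)) f g \<in> J"
  proof (rule minor_expand_column[OF J])
    fix i assume i: "i < Suc (t + e)"
    then show "(f i, g 0) \<in> V" using Suc.prems by (intro Suc.prems(2)) auto
    show "minor (t + e) (\<lambda>l. if l < i then f l else f (Suc l)) (\<lambda>l. g (Suc l)) \<in> J"
    proof (rule Suc.IH)
      show "(\<lambda>l. if l < i then f l else f (Suc l)) ` {..<t + e} \<subseteq> X"
        using Suc.prems(4) by auto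
      show "minor t f' (\<lambda>l. g (Suc (e + l))) \<in> J"
        if "strict_mono_on {..<t} f'" "f' ` {..<t} \<subseteq> X" for f'
        using Suc.prems(1)[OF that] by simp
      show "strict_mono_on {..<t + e} (\<lambda>l. if l < i then f l else f (Suc l))"
        using Suc.prems(3) by (intro strict_mono_on_skip) simp
    qed (use Suc.prems(2) in simp)
  qed
  then show ?case by simp
qed

lemma strict_mono_on_gap:
  fixes f :: "nat \<Rightarrow> nat"
  assumes "strict_mono_on {..<s} f" "i \<le> j" "j < s"
  shows "f i + (j - i) \<le> f j"
  using assms(2,3)
proof (induction j rule: dec_induct)
  case (step j)
  have "f j < f (Suc j)" using assms(1) step.prems by (auto simp: strict_mono_on_def)
  then show ?case using step by auto
qed simp

subsection \<open>Determinantal ideals\<close>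

lemma minor_in_polys:
  assumes "\<And>i j. i < s \<Longrightarrow> j < s \<Longrightarrow> (f i, g j) \<in> V"
  shows "minor s f g \<in> polys V"
proof -
  have "signof p \<in> polys V" for p :: "nat \<Rightarrow> nat"
    by (auto simp: sign_def intro: polys_uminus)
  then show ?thesis
    unfolding minor_def det_def using assms
    by (auto intro!: polys_sum polys_mult polys_prod polys_indet dest: permutes_in_image)
qed

lemma minors_in_polys: "M \<subseteq> L \<Longrightarrow> minors_in m n s M \<subseteq> polys L"
  by (auto elim!: minors_in_cases intro!: minor_in_polys)

lemma
  assumes "M \<subseteq> L"
  shows ideal_minor_ideal: "ideal (minor_ideal m n L s M) (poly_ring L :: 'k::comm_ring_1 mpoly ring)"
    and minors_in_subset_minor_ideal: "minors_in m n s M \<subseteq> (minor_ideal m n L s M :: 'k mpoly set)"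
proof -
  interpret R: cring "poly_ring L :: 'k mpoly ring" by (rule cring_poly_ring)
  have "minors_in m n s M \<subseteq> carrier (poly_ring L :: 'k mpoly ring)"
    using minors_in_polys[OF assms] by simp
  then show "ideal (minor_ideal m n L s M) (poly_ring L :: 'k mpoly ring)"
    and "minors_in m n s M \<subseteq> (minor_ideal m n L s M :: 'k mpoly set)"
    unfolding minor_ideal_def by (rule R.genideal_ideal, rule R.genideal_self)
qed

lemma minor_ideal_subset:
  assumes "ideal J (poly_ring L)" "minors_in m n s M \<subseteq> J"
  shows "minor_ideal m n L s M \<subseteq> J"
  unfolding minor_ideal_def
  by (rule ring.genideal_minimal[OF cring.axioms(1)[OF cring_poly_ring] assms])

lemma ladder_part_subset: "ladder_part L d c j \<subseteq> L"
  by (auto simp: ladder_part_def)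

lemma minors_in_subset_mixed_ladder_ideal:
  assumes j: "j \<in> {1..k}"
  shows "minors_in m n (t j) (ladder_part L d c j) \<subseteq> (mixed_ladder_ideal m n L k d c t :: 'k::comm_ring_1 mpoly set)"
proof
  fix D :: "'k mpoly" assume D: "D \<in> minors_in m n (t j) (ladder_part L d c j)"
  let ?f = "\<lambda>i. if i = j then D else 0"
  have "?f i \<in> minor_ideal m n L (t i) (ladder_part L d c i)" for i
    using subsetD[OF minors_in_subset_minor_ideal[OF ladder_part_subset] D]
      ideal_polysD(2)[OF ideal_minor_ideal[OF ladder_part_subset]]
    by (cases "i = j") auto
  moreover have "(\<Sum>i = 1..k. ?f i) = D" using j by simp
  ultimately show "D \<in> mixed_ladder_ideal m n L k d c t"
    unfolding mixed_ladder_ideal_def by (intro CollectI exI[of _ ?f]) simp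
qed

lemma mixed_ladder_ideal_subset:
  assumes J: "ideal J (poly_ring L :: 'k::comm_ring_1 mpoly ring)"
    and "\<And>j. j \<in> {1..k} \<Longrightarrow> minors_in m n (t j) (ladder_part L d c j) \<subseteq> J"
  shows "mixed_ladder_ideal m n L k d c t \<subseteq> J"
proof
  fix p :: "'k mpoly" assume "p \<in> mixed_ladder_ideal m n L k d c t"
  then obtain f where p: "p = (\<Sum>j = 1..k. f j)"
    and f: "\<And>j. j \<in> {1..k} \<Longrightarrow> f j \<in> minor_ideal m n L (t j) (ladder_part L d c j)"
    unfolding mixed_ladder_ideal_def by blast
  show "p \<in> J"
    unfolding p using f minor_ideal_subset[OF J] assms(2) by (intro ideal_sum[OF J]) blast
qed

text \<open>If a corner were too close to another one, then every minor of one of the two blocks could be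
  expanded into minors of the other.\<close>

lemma corner_distance_rows:
  assumes "i \<in> {1..k}" "L \<subseteq> {1..m} \<times> {1..n}" "d i \<le> d j" "c i \<le> c j"
    and "\<not> (minor_ideal m n L (t j) (ladder_part L d c j) :: 'k::comm_ring_1 mpoly set)
            \<subseteq> minor_ideal m n L (t i) (ladder_part L d c i)"
  shows "d i + t j < d j + t i"
proof (rule ccontr)
  let ?J = "minor_ideal m n L (t i) (ladder_part L d c i) :: 'k mpoly set"
  assume "\<not> ?thesis"
  then have le: "d j + t i \<le> d i + t j" by simp
  then have tij: "t i \<le> t j" using assms(3) by linarith
  have J: "ideal ?J (poly_ring L)" by (rule ideal_minor_ideal[OF ladder_part_subset])
  have "minor (t j) f g \<in> ?J"
    if f: "strict_mono_on {..<t j} f" and g: "strict_mono_on {..<t j} g"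
      and fg: "\<And>r s. r < t j \<Longrightarrow> s < t j \<Longrightarrow> (f r, g s) \<in> ladder_part L d c j" for f g
  proof (rule minor_mem_drop_rows[OF J tij])
    let ?X = "{x. \<forall>r<t j. (f r, x) \<in> ladder_part L d c j}"
    show "g ` {..<t j} \<subseteq> ?X" using fg by auto
    show "(f r, x) \<in> L" if "r < t j" "x \<in> ?X" for r x
      using that by (auto simp: ladder_part_def)
    fix g' assume g': "strict_mono_on {..<t i} g'" "g' ` {..<t i} \<subseteq> ?X"
    have mem: "(f r, g' s) \<in> ladder_part L d c i" if "r < t i" "s < t i" for r s
    proof -
      have r: "r < t j" "t j - 1 < t j" using that tij by auto
      have X: "(f r', g' s) \<in> ladder_part L d c j" if "r' < t j" for r'
        using g'(2) \<open>s < t i\<close> that by auto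
      \<comment> \<open>Below row \<open>f r\<close> there are \<open>t j - 1 - r\<close> further
        rows of the minor, all at most \<open>d j\<close>. For \<open>r < t i\<close> this pushes
        \<open>f r\<close> up to at most \<open>d i\<close>.\<close>
      have "f r + (t j - 1 - r) \<le> f (t j - 1)" using r by (intro strict_mono_on_gap[OF f]) auto
      moreover have "f (t j - 1) \<le> d j" using X[OF r(2)] by (auto simp: ladder_part_def)
      ultimately have "f r \<le> d i" using le that by linarith
      then show ?thesis using X[OF r(1)] assms(4) by (auto simp: ladder_part_def)
    qed
    have "f r \<in> {1..m}" "g' r \<in> {1..n}" if "r < t i" for r
      using mem[OF that that] assms(2) by (auto simp: ladder_part_def)
    then have "minor (t i) f g' \<in> minors_in m n (t i) (ladder_part L d c i)"
      using g'(1) mem f tij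
      by (intro minor_in_minors_in) (auto simp: strict_mono_on_def)
    then show "minor (t i) f g' \<in> ?J"
      using minors_in_subset_minor_ideal[OF ladder_part_subset] by blast
  qed (rule g)
  then have "minors_in m n (t j) (ladder_part L d c j) \<subseteq> ?J"
    by (auto elim!: minors_in_cases)
  then show False using minor_ideal_subset[OF J] assms(5) by blast
qed

lemma corner_distance_columns:
  assumes "L \<subseteq> {1..m} \<times> {1..n}" "d i \<le> d j" "c i \<le> c j"
    and "\<not> (minor_ideal m n L (t i) (ladder_part L d c i) :: 'k::comm_ring_1 mpoly set)
            \<subseteq> minor_ideal m n L (t j) (ladder_part L d c j)"
  shows "c i + t i < c j + t j"
proof (rule ccontr)
  let ?J = "minor_ideal m n L (t j) (ladder_part L d c j) :: 'k mpoly set"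
  assume "\<not> ?thesis"
  then have le: "c j + t j \<le> c i + t i" by simp
  \<comment> \<open>The assumptions \<open>c i \<le> c j\<close> and \<open>le\<close> give
    \<open>t j \<le> t i\<close>, so the difference is exact.\<close>
  define e where "e = t i - t j"
  have ti: "t i = t j + e" using le assms(3) by (simp add: e_def)
  have J: "ideal ?J (poly_ring L)" by (rule ideal_minor_ideal[OF ladder_part_subset])
  have "minor (t j + e) f g \<in> ?J"
    if f: "strict_mono_on {..<t j + e} f" and g: "strict_mono_on {..<t j + e} g"
      and fg: "\<And>r s. r < t j + e \<Longrightarrow> s < t j + e \<Longrightarrow> (f r, g s) \<in> ladder_part L d c i" for f g
  proof (rule minor_mem_drop_columns[OF J])
    let ?X = "{x. \<forall>s<t j + e. (x, g s) \<in> ladder_part L d c i}"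
    show "f ` {..<t j + e} \<subseteq> ?X" using fg by auto
    show "(x, g s) \<in> L" if "s < t j + e" "x \<in> ?X" for s x
      using that by (auto simp: ladder_part_def)
    fix f' assume f': "strict_mono_on {..<t j} f'" "f' ` {..<t j} \<subseteq> ?X"
    have mem: "(f' r, g (e + s)) \<in> ladder_part L d c j" if "r < t j" "s < t j" for r s
    proof -
      have X: "(f' r, g s') \<in> ladder_part L d c i" if "s' < t j + e" for s'
        using f'(2) \<open>r < t j\<close> that by auto
      \<comment> \<open>To the left of column \<open>g (e + s)\<close> there are at least
        \<open>e\<close> columns of the minor, all at least \<open>c i\<close>, and
        \<open>c i + e \<ge> c j\<close>.\<close>
      have "g 0 + (e + s - 0) \<le> g (e + s)" using that by (intro strict_mono_on_gap[OF g]) auto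
      moreover have "c i \<le> g 0" using X[of 0] that by (auto simp: ladder_part_def)
      ultimately have "c j \<le> g (e + s)" using le ti by linarith
      then show ?thesis using X[of "e + s"] that assms(2) by (auto simp: ladder_part_def)
    qed
    have "f' r \<in> {1..m}" "g (e + r) \<in> {1..n}" if "r < t j" for r
      using mem[OF that that] assms(1) by (auto simp: ladder_part_def)
    moreover have "strict_mono_on {..<t j} (\<lambda>l. g (e + l))"
      using g by (auto simp: strict_mono_on_def)
    ultimately have "minor (t j) f' (\<lambda>l. g (e + l)) \<in> minors_in m n (t j) (ladder_part L d c j)"
      using f'(1) mem by (intro minor_in_minors_in) auto
    then show "minor (t j) f' (\<lambda>l. g (e + l)) \<in> ?J"
      using minors_in_subset_minor_ideal[OF ladder_part_subset] by blast
  qed (rule f)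
  then have "minors_in m n (t i) (ladder_part L d c i) \<subseteq> ?J"
    unfolding ti by (auto elim!: minors_in_cases)
  then show False using minor_ideal_subset[OF J] assms(4) by blast
qed

subsection \<open>The height\<close>

text \<open>The value at the identity matrix is 1. This makes invertibility of the squares a
  nonempty open condition.\<close>

lemma minor_identity_nonzero: "minor s (\<lambda>q. r + q) (\<lambda>p. r' + p) \<noteq> (0 :: 'k::comm_ring_1 mpoly)"
proof
  let ?\<sigma> = "\<lambda>(x, y). if x - r = y - r' then 1 else 0 :: 'k"
  assume "minor s (\<lambda>q. r + q) (\<lambda>p. r' + p) = (0 :: 'k mpoly)"
  then have "det (mat s s (\<lambda>(i, j). ?\<sigma> (r + i, r' + j))) = 0"
    using poly_val_minor[OF id_hom, of ?\<sigma> s "\<lambda>q. r + q" "\<lambda>p. r' + p"]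
    by (simp add: poly_val_zero[OF id_hom])
  moreover have "mat s s (\<lambda>(i, j). ?\<sigma> (r + i, r' + j)) = 1\<^sub>m s"
    by (intro eq_matI) auto
  ultimately show False by simp
qed

lemma vanishing_ideal:
  "ideal {p \<in> polys V. \<forall>X\<in>G. poly_val (\<lambda>c. c) X p = (0 :: 'k::comm_ring_1)} (poly_ring V)"
  by (rule ideal_polysI)
    (auto simp: poly_val_zero[OF id_hom] poly_val_add[OF id_hom] poly_val_mult[OF id_hom])

lemma mixed_ladder_prime:
  fixes L :: "(nat \<times> nat) set"
  assumes inf: "infinite (UNIV :: 'k::field set)"
    and L: "L = ladder h b a k d c" "L \<subseteq> {1..m} \<times> {1..n}"
    and t: "\<And>j. j \<in> {1..k} \<Longrightarrow> 1 \<le> t j" and dm: "\<And>j. j \<in> {1..k} \<Longrightarrow> d j \<le> m"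
    and mono: "\<And>i j. i \<in> {1..k} \<Longrightarrow> j \<in> {1..k} \<Longrightarrow> i < j \<Longrightarrow> d i \<le> d j \<and> c i \<le> c j"
    and sep: "\<And>i j. i \<in> {1..k} \<Longrightarrow> j \<in> {1..k} \<Longrightarrow> i < j \<Longrightarrow> d i + t j < d j + t i \<and> c i + t i < c j + t j"
  obtains P where "primeideal P (poly_ring L :: 'k mpoly ring)" "mixed_ladder_ideal m n L k d c t \<subseteq> P"
    "polys (L - subladder h b a k d c t) \<inter> P = {0}"
proof -
  let ?ev = "poly_val (\<lambda>c :: 'k. c)" and ?B = "L - subladder h b a k d c t"
  \<comment> \<open>\<open>G\<close> is the set of common zeros of the generating minors. Its
    vanishing ideal contains the mixed ideal and will be shown to avoid all nonzero polynomials in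
    \<open>L - L'\<close>.\<close>
  define G :: "(nat \<times> nat \<Rightarrow> 'k) set" where
    "G = {X. \<forall>j\<in>{1..k}. \<forall>D\<in>minors_in m n (t j) (ladder_part L d c j). ?ev X D = 0}"
  define J where "J = {p \<in> polys L. \<forall>X\<in>G. ?ev X p = 0}"
  have J: "ideal J (poly_ring L)" unfolding J_def by (rule vanishing_ideal)
  have sub: "mixed_ladder_ideal m n L k d c t \<subseteq> J"
  proof (rule mixed_ladder_ideal_subset[OF J])
    fix j assume "j \<in> {1..k}"
    then show "minors_in m n (t j) (ladder_part L d c j) \<subseteq> J"
      using minors_in_polys[OF ladder_part_subset] unfolding J_def G_def by blast
  qed
  have "p = 0" if p: "p \<in> polys ?B" "p \<in> J" for p
  proof (rule ccontr)
    assume "p \<noteq> 0"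
    \<comment> \<open>A block with \<open>t j > d j\<close> contains no minor of size
      \<open>t j\<close>, since the \<open>t j\<close> distinct rows would lie in
      \<open>{1..d j}\<close>. It imposes no rank condition.\<close>
    define I where "I = {j \<in> {1..k}. t j \<le> d j}"
    let ?D = "\<lambda>j. minor (t j - 1) (\<lambda>q. d j + 2 - t j + q) (\<lambda>p. c j + p) :: 'k mpoly"
    \<comment> \<open>The point is chosen generic in two respects at once: \<open>p\<close> does not
      vanish there, and the squares of all blocks become invertible.\<close>
    let ?F = "insert p (?D ` I)"
    define V where "V = (\<Union>p\<in>?F. \<Union>u\<in>keys p. keys u)"
    have "finite ?F" by (simp add: I_def)
    then have "finite V" unfolding V_def by (intro finite_UN_I) auto
    have "?F \<subseteq> polys V" unfolding polys_def V_def by blast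
    moreover have "0 \<notin> ?F" using \<open>p \<noteq> 0\<close> minor_identity_nonzero by fastforce
    ultimately obtain \<sigma> where \<sigma>: "\<And>q. q \<in> ?F \<Longrightarrow> ?ev \<sigma> q \<noteq> 0"
      using nonvanishing_point[OF inf \<open>finite V\<close> \<open>finite ?F\<close>] by blast
    let ?Hole = "\<lambda>j. {(r, s). r \<le> d j + 1 - t j \<and> c j + t j - 1 \<le> s}"
    have "\<exists>X. (\<forall>x. x \<notin> \<Union> (?Hole ` I) \<longrightarrow> X x = \<sigma> x) \<and>
      (\<forall>j\<in>I. \<exists>Y Z. \<forall>r s. r \<le> d j \<longrightarrow> c j \<le> s \<longrightarrow> X (r, s) = (\<Sum>p<t j - 1. Y r p * Z p s))"
    proof (rule rank_completion)
      fix j assume "j \<in> I"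
      then have "?ev \<sigma> (?D j) \<noteq> 0" using \<sigma> by blast
      then show "det (mat (t j - 1) (t j - 1) (\<lambda>(q, p). \<sigma> (d j + 2 - t j + q, c j + p))) \<noteq> 0"
        by (simp add: poly_val_minor[OF id_hom])
    qed (use t dm mono sep in \<open>auto simp: I_def\<close>)
    then obtain X where X: "\<And>x. x \<notin> \<Union> (?Hole ` I) \<Longrightarrow> X x = \<sigma> x"
      and low: "\<And>j. j \<in> I \<Longrightarrow> \<exists>Y Z. \<forall>r s. r \<le> d j \<longrightarrow> c j \<le> s \<longrightarrow> X (r, s) = (\<Sum>p<t j - 1. Y r p * Z p s)"
      by blast
    have "X \<in> G"
      unfolding G_def
    proof (intro CollectI ballI)
      fix j and D :: "'k mpoly" assume j: "j \<in> {1..k}" and D: "D \<in> minors_in m n (t j) (ladder_part L d c j)"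
      have "\<exists>f g. strict_mono_on {..<t j} f \<and> D = minor (t j) f g \<and>
          (\<forall>i<t j. \<forall>i'<t j. (f i, g i') \<in> ladder_part L d c j)"
        using D by (rule minors_in_cases) blast
      then obtain f g where f: "strict_mono_on {..<t j} f"
        and fg: "\<And>i i'. i < t j \<Longrightarrow> i' < t j \<Longrightarrow> (f i, g i') \<in> ladder_part L d c j" "D = minor (t j) f g"
        by blast
      have bounds: "1 \<le> f i" "f i \<le> d j" "c j \<le> g i" if "i < t j" for i
        using fg(1)[OF that that] L(2) by (auto simp: ladder_part_def)
      have "f 0 + (t j - 1 - 0) \<le> f (t j - 1)" using t[OF j] by (intro strict_mono_on_gap[OF f]) auto
      then have "t j \<le> d j" using bounds(1)[of 0] bounds(2)[of "t j - 1"] t[OF j] by auto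
      then obtain Y Z where YZ: "\<And>r s. r \<le> d j \<Longrightarrow> c j \<le> s \<Longrightarrow> X (r, s) = (\<Sum>p<t j - 1. Y r p * Z p s)"
        using low[of j] j by (auto simp: I_def)
      have "mat (t j) (t j) (\<lambda>(i, i'). X (f i, g i')) =
            mat (t j) (t j) (\<lambda>(i, i'). \<Sum>p<t j - 1. Y (f i) p * Z p (g i'))"
        by (intro eq_matI) (simp_all add: YZ bounds)
      then show "?ev X D = 0"
        using det_low_rank[OF t[OF j], of "\<lambda>i. Y (f i)" "\<lambda>p i'. Z p (g i')"]
        by (simp add: fg(2) poly_val_minor[OF id_hom])
    qed
    then have "?ev X p = 0" using p(2) by (simp add: J_def)
    moreover have "?ev X p = ?ev \<sigma> p"
    proof (rule poly_val_cong[OF p(1)])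
      fix x assume x: "x \<in> ?B"
      \<comment> \<open>A position of \<open>L\<close> inside a hole also has an upper corner from
        \<open>L\<close>, so it belongs to \<open>L'\<close>. Completion thus leaves the values on
        \<open>L - L'\<close> unchanged.\<close>
      have "x \<notin> ?Hole j" if "j \<in> I" for j
      proof
        assume hole: "x \<in> ?Hole j"
        have "x \<in> ladder h b a k d c" using x L(1) by blast
        then obtain i where "i \<in> {1..h}" "b i \<le> fst x" "snd x \<le> a i" by (rule ladderE)
        then have "(fst x, snd x) \<in> subladder h b a k d c t"
          unfolding subladder_def using hole that by (intro ladderI[of i _ j]) (auto simp: I_def)
        then show False using x by simp
      qed
      then show "X x = \<sigma> x" by (intro X) blast
    qed
    ultimately show False using \<sigma>[of p] by simp
  qed
  then have "polys ?B \<inter> J = {0}" using ideal_polysD(2)[OF J] by auto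
  then obtain P where "primeideal P (poly_ring L)" "J \<subseteq> P" "polys ?B \<inter> P = {0}"
    by (rule primeideal_avoiding[OF J]) auto
  then show ?thesis using that sub by blast
qed

lemma mixed_ladder_prime_height:
  assumes L: "L = ladder h b a k d c" "L \<subseteq> {1..m} \<times> {1..n}"
    and t: "\<And>j. j \<in> {1..k} \<Longrightarrow> 1 \<le> t j" and b: "\<And>i. i \<in> {1..h} \<Longrightarrow> 1 \<le> b i"
    and P: "primeideal P (poly_ring L :: 'k::field mpoly ring)" "mixed_ladder_ideal m n L k d c t \<subseteq> P"
  shows "enat (card (subladder h b a k d c t)) \<le> prime_height (poly_ring L) P"
proof -
  have fin: "finite L" using L(2) by (rule finite_subset) simp
  obtain B l Q where B: "B \<subseteq> L" "polys B \<inter> P = {0}" "l + card B = card L"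
    and Q: "prime_chain L l Q" "Q l = P"
    using prime_chain_exists[OF fin P(1)] by blast
  have "reducible_supports P L (ladder_support L k d c t)"
  proof (rule reducible_supports_ladder[OF L t])
    fix j assume "j \<in> {1..k}"
    then show "minors_in m n (t j) (ladder_part L d c j) \<subseteq> P"
      using minors_in_subset_mixed_ladder_ideal P(2) by blast
  qed
  then have "card B \<le> card (L - subladder h b a k d c t)"
    by (rule independent_card_le[OF fin primeideal_polysD(1)[OF P(1)] _ _ B(1,2)])
      (rule card_ladder_support[OF L(1) fin t b])
  moreover have sub: "subladder h b a k d c t \<subseteq> L"
    unfolding L(1) using t by (rule subladder_subset)
  ultimately have "card (subladder h b a k d c t) \<le> l"
    using B(3) fin card_mono[OF fin sub] by (simp add: card_Diff_subset finite_subset)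
  then have "enat (card (subladder h b a k d c t)) \<le> enat l" by simp
  also have "\<dots> \<le> prime_height (poly_ring L) P"
    unfolding prime_height_def using Q by (intro Sup_upper) (auto simp: prime_chain_def)
  finally show ?thesis .
qed

theorem theorem1p15:
  fixes m n h k :: nat and b a d c t :: "nat \<Rightarrow> nat" and L :: "(nat \<times> nat) set"
  assumes "m \<le> n"
    and "h \<ge> 1" and "k \<ge> 1"
    and "b 1 = 1" and "strict_mono_on {1..h} b" and "b h \<le> m"
    and "1 \<le> a 1" and "strict_mono_on {1..h} a" and "a h = n"
    and "1 \<le> d 1" and "mono_on {1..k} d" and "d k = m"
    and "c 1 = 1" and "mono_on {1..k} c" and "c k \<le> n"
    and "inj_on (\<lambda>j. (d j, c j)) {1..k}"
    and L: "L = ladder h b a k d c"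
    and "\<forall>j\<in>{1..k}. t j \<ge> 1"
    and "\<forall>x\<in>L. \<exists>j\<in>{1..k}. \<exists>A B. card A = t j \<and> card B = t j \<and>
           A \<times> B \<subseteq> ladder_part L d c j \<and> x \<in> A \<times> B"
    and "\<forall>i\<in>{1..k}. \<forall>j\<in>{1..k}. i \<noteq> j \<longrightarrow>
           \<not> (minor_ideal m n L (t i) (ladder_part L d c i) :: 'k::alg_closed_field mpoly set)
             \<subseteq> minor_ideal m n L (t j) (ladder_part L d c j)"
  shows "ideal_height (poly_ring L)
           (mixed_ladder_ideal m n L k d c t :: 'k::alg_closed_field mpoly set)
         = enat (card (subladder h b a k d c t))"
proof -
  let ?I = "mixed_ladder_ideal m n L k d c t :: 'k mpoly set" and ?L' = "subladder h b a k d c t"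
  have t: "1 \<le> t j" if "j \<in> {1..k}" for j using assms(18) that by blast
  have b: "1 \<le> b i" if "i \<in> {1..h}" for i
    using strict_mono_on_imp_mono_on[OF assms(5)] assms(4) that
    by (auto simp: mono_on_def dest: spec[of _ 1])
  have a: "a i \<le> n" if "i \<in> {1..h}" for i
    using strict_mono_on_imp_mono_on[OF assms(8)] assms(9) that by (auto simp: mono_on_def)
  have dm: "d j \<le> m" if "j \<in> {1..k}" for j
    using assms(11,12) that by (auto simp: mono_on_def)
  have c: "1 \<le> c j" if "j \<in> {1..k}" for j
    using assms(13,14) that by (auto simp: mono_on_def dest: spec[of _ 1])
  have Lmn: "L \<subseteq> {1..m} \<times> {1..n}"
  proof
    fix x assume "x \<in> L"
    then obtain i j where "i \<in> {1..h}" "j \<in> {1..k}" "b i \<le> fst x" "fst x \<le> d j" "c j \<le> snd x" "snd x \<le> a i"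
      unfolding L by (rule ladderE)
    then have "1 \<le> fst x" "fst x \<le> m" "1 \<le> snd x" "snd x \<le> n"
      using a[of i] b[of i] c[of j] dm[of j] by simp_all
    then show "x \<in> {1..m} \<times> {1..n}" by (simp add: mem_Times_iff)
  qed
  have fin: "finite L" using Lmn by (rule finite_subset) simp
  have mono: "d i \<le> d j \<and> c i \<le> c j" if "i \<in> {1..k}" "j \<in> {1..k}" "i < j" for i j
    using assms(11,14) that by (auto simp: mono_on_def)
  \<comment> \<open>Both directions of non-containment are used: the minors of \<open>j\<close> not
    lying in the ideal of \<open>i\<close> gives the inequality for the rows, the converse that for
    the columns.\<close>
  have sep: "d i + t j < d j + t i \<and> c i + t i < c j + t j"
    if ij: "i \<in> {1..k}" "j \<in> {1..k}" "i < j" for i j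
    using corner_distance_rows[OF ij(1) Lmn, of d j c t, where 'k = 'k]
      corner_distance_columns[OF Lmn, of d i j c t, where 'k = 'k] mono[OF ij] assms(20) ij
    by (metis less_irrefl)
  show ?thesis
  proof (rule antisym)
    obtain P where P: "primeideal P (poly_ring L :: 'k mpoly ring)" "?I \<subseteq> P" "polys (L - ?L') \<inter> P = {0}"
      by (rule mixed_ladder_prime[OF infinite_alg_closed_field L Lmn t dm mono sep])
    have "prime_height (poly_ring L) P \<le> enat (card ?L')"
      unfolding prime_height_def
    proof (rule Sup_least)
      fix x assume "x \<in> {enat l | l. \<exists>Q. (\<forall>i\<le>l. primeideal (Q i) (poly_ring L)) \<and>
        (\<forall>i<l. Q i \<subset> Q (Suc i)) \<and> Q l = P}"
      then obtain l Q where x: "x = enat l" and Q: "prime_chain L l Q" "Q l = P"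
        unfolding prime_chain_def by blast
      have "l + card (L - ?L') \<le> card L"
        using prime_chain_length[OF fin Q(1), of "L - ?L'"] P(3) Q(2) by blast
      moreover have sub: "?L' \<subseteq> L" unfolding L using t by (rule subladder_subset)
      ultimately show "x \<le> enat (card ?L')"
        using card_mono[OF fin sub] x fin by (simp add: card_Diff_subset finite_subset)
    qed
    moreover have "ideal_height (poly_ring L) ?I \<le> prime_height (poly_ring L) P"
      unfolding ideal_height_def using P(1,2) by (intro Inf_lower) blast
    ultimately show "ideal_height (poly_ring L) ?I \<le> enat (card ?L')" by (rule order_trans[rotated])
    show "enat (card ?L') \<le> ideal_height (poly_ring L) ?I"
      unfolding ideal_height_def
    proof (rule Inf_greatest)
      fix x assume "x \<in> {prime_height (poly_ring L) P | P. primeideal P (poly_ring L) \<and> ?I \<subseteq> P}"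
      then obtain P where x: "x = prime_height (poly_ring L) P"
        and P: "primeideal P (poly_ring L)" "?I \<subseteq> P" by blast
      show "enat (card ?L') \<le> x"
        unfolding x by (rule mixed_ladder_prime_height[OF L Lmn t b P])
    qed
  qed
qed

end
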